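(* Let $z_1,z_2,z_3\in\mathbb{D}$ be distinct and let $w_1,w_2\in\mathbb{D}$. There exists a holomorphic function $F:\mathbb{D}\to\mathbb{D}$ with $F(z_1)=w_1$, $F(z_2)=w_2$ and $F'(z_3)=0$ if and only if $$\rho(w_1,w_2)\le c_N\big(p(\phi_{z_3}(z_1)),\,p(\phi_{z_3}(z_2))\big).$$ Moreover, if equality holds in this inequality, then the function $F$ with these properties is unique and is a Blaschke product of order two or three.
   Context: $\mathbb{D}$ is the open unit disk in $\mathbb{C}$. The Neil parabola is $N=\{(z,w)\in\mathbb{D}^2: z^2=w^3\}$, and $p:\mathbb{D}\to N$ is the bijective map $p(\lambda)=(\lambda^3,\lambda^2)$. For $\alpha\in\mathbb{D}$, $\phi_\alpha(z)=\frac{\alpha-z}{1-\bar{\alpha}z}$. For $a,b\in\mathbb{D}$, $m(a,b)=\left|\frac{a-b}{1-\bar a b}\right|$ and $\rho(a,b)=\tanh^{-1}m(a,b)$ (Poincaré distance). A function $f:N\to\mathbb{C}$ is holomorphic if for each $x\in N$ there is a holomorphic function $F$ on a neighborhood $U$ of $x$ in $\mathbb{D}^2$ with $F=f$ on $U\cap N$; $\mathcal{O}(N,\mathbb{D})$ is the set of holomorphic functions on $N$ with values in $\mathbb{D}$. The Carathéodory pseudodistance on $N$ is $c_N(x,y)=\sup\{\rho(f(x),f(y)): f\in\mathcal{O}(N,\mathbb{D})\}$. A Blaschke product of order $n$ is a finite Blaschke product with $n$ factors (a unimodular constant times a product of $n$ functions $\phi_{\alpha_j}$, $\alpha_j\in\mathbb{D}$).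 *)

theory Defs
  imports "HOL-Complex_Analysis.Complex_Analysis"
begin

abbreviation unit_disc :: "complex set" where
  "unit_disc \<equiv> ball 0 1"

definition neil_parabola :: "(complex \<times> complex) set" where
  "neil_parabola = {(z, w). z \<in> unit_disc \<and> w \<in> unit_disc \<and> z ^ 2 = w ^ 3}"

definition neil_param :: "complex \<Rightarrow> complex \<times> complex" where
  "neil_param l = (l ^ 3, l ^ 2)"

definition disc_aut :: "complex \<Rightarrow> complex \<Rightarrow> complex" where
  "disc_aut a z = (a - z) / (1 - cnj a * z)"

definition pseudo_hyperbolic_dist :: "complex \<Rightarrow> complex \<Rightarrow> real" where
  "pseudo_hyperbolic_dist a b = norm ((a - b) / (1 - cnj a * b))"

definition poincare_dist :: "complex \<Rightarrow> complex \<Rightarrow> real" where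
  "poincare_dist a b = artanh (pseudo_hyperbolic_dist a b)"

text \<open>The library's notion of holomorphy covers one complex variable only. In two variables:
  Frechet differentiability with complex-linear derivative at each point (used on open sets).\<close>

definition holomorphic2_on :: "(complex \<times> complex \<Rightarrow> complex) \<Rightarrow> (complex \<times> complex) set \<Rightarrow> bool" where
  "holomorphic2_on F U \<longleftrightarrow>
     (\<forall>x\<in>U. \<exists>a b. (F has_derivative (\<lambda>(h, k). a * h + b * k)) (at x))"

definition holomorphic_on_neil :: "(complex \<times> complex \<Rightarrow> complex) \<Rightarrow> bool" where
  "holomorphic_on_neil f \<longleftrightarrow>
     (\<forall>x\<in>neil_parabola. \<exists>U F. open U \<and> x \<in> U \<and> U \<subseteq> unit_disc \<times> unit_disc \<and>
        holomorphic2_on F U \<and> (\<forall>y\<in>U \<inter> neil_parabola. F y = f y))"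

definition neil_holo_disc :: "(complex \<times> complex \<Rightarrow> complex) set" where
  "neil_holo_disc = {f. holomorphic_on_neil f \<and> f ` neil_parabola \<subseteq> unit_disc}"

text \<open>For points of the Neil parabola the supremum is over a bounded set of reals: by the
  Schwarz--Pick lemma for \<open>f \<circ> neil_param\<close>, the distance between \<open>f (neil_param a)\<close> and
  \<open>f (neil_param b)\<close> is at most \<open>poincare_dist a b\<close>.\<close>

definition caratheodory_neil :: "complex \<times> complex \<Rightarrow> complex \<times> complex \<Rightarrow> real" where
  "caratheodory_neil x y = (SUP f\<in>neil_holo_disc. poincare_dist (f x) (f y))"

definition blaschke_product_of_order :: "nat \<Rightarrow> (complex \<Rightarrow> complex) \<Rightarrow> bool" where
  "blaschke_product_of_order n F \<longleftrightarrow>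
     (\<exists>c \<alpha>. norm c = 1 \<and> (\<forall>j<n. \<alpha> j \<in> unit_disc) \<and>
        (\<forall>z\<in>unit_disc. F z = c * (\<Prod>j<n. disc_aut (\<alpha> j) z)))"

definition interpolates ::
  "complex \<Rightarrow> complex \<Rightarrow> complex \<Rightarrow> complex \<Rightarrow> complex \<Rightarrow> (complex \<Rightarrow> complex) \<Rightarrow> bool" where
  "interpolates z\<^sub>1 z\<^sub>2 z\<^sub>3 w\<^sub>1 w\<^sub>2 F \<longleftrightarrow>
     F holomorphic_on unit_disc \<and> F ` unit_disc \<subseteq> unit_disc \<and>
     F z\<^sub>1 = w\<^sub>1 \<and> F z\<^sub>2 = w\<^sub>2 \<and> deriv F z\<^sub>3 = 0"

end

theory Submission
  imports Defs "HOL-Computational_Algebra.Fundamental_Theorem_Algebra"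
begin

text \<open>
  Write \<open>\<phi>\<^sub>a\<close> for \<^term>\<open>disc_aut a\<close>, \<open>m\<close> for the pseudohyperbolic distance, and call a holomorphic
  self-map of the disc whose derivative vanishes at \<open>a\<close> a critical self-map (at \<open>a\<close>). The
  interpolating functions are the critical self-maps at \<open>z\<^sub>3\<close> with two prescribed values.

  Critical self-maps at \<open>0\<close> are exactly the functions \<open>f \<circ> p\<close>, where \<open>p(l) = (l\<^sup>3, l\<^sup>2)\<close> and \<open>f\<close> is a
  holomorphic function from the Neil parabola to the disc. Indeed \<open>p'(0) = 0\<close> forces
  \<open>(f \<circ> p)'(0) = 0\<close>; conversely a power series without linear term splits into its even and odd
  parts as \<open>E(l\<^sup>2) + l\<^sup>3 B(l\<^sup>2)\<close>, which is the function \<open>E(w) + z B(w)\<close> restricted to the parabola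
  (\<open>critical_self_map_neil_pullback\<close>, \<open>critical_self_map_neil_pushforward\<close>). After moving \<open>0\<close> to \<open>z\<^sub>3\<close>
  with \<open>\<phi>\<close>, the Caratheodory distance in the theorem is therefore the supremum of the Poincare
  distances \<open>\<rho>(F z\<^sub>1, F z\<^sub>2)\<close> over critical self-maps \<open>F\<close> at \<open>z\<^sub>3\<close>.

  By Montel's theorem this supremum is attained, by some \<open>F\<^sub>0\<close> (\<open>extremal_self_map_exists\<close>). The class
  of critical self-maps is stable under composition on the left with self-maps of the disc, and two
  points of the disc can be mapped to any two points that are at most equally far apart
  (\<open>disc_two_point_interpolation\<close>). So every admissible pair \<open>w\<^sub>1, w\<^sub>2\<close> is reached from \<open>F\<^sub>0\<close>, which
  gives the solvability criterion.

  Now let \<open>F\<close> be extremal. Composing with \<open>\<phi>\<^bsub>F(a)\<^esub>\<close>, where \<open>a = z\<^sub>3\<close>, one may assume \<open>F(a) = 0\<close>; then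
  \<open>F = \<phi>\<^sub>a\<^sup>2 H\<close> by two applications of the Schwarz lemma, where \<open>H\<close> is a unimodular constant or a
  self-map of the disc. In the first case \<open>F\<close> is a Blaschke product of order two. In the second case
  either \<open>m(H z\<^sub>1, H z\<^sub>2) = m(z\<^sub>1, z\<^sub>2)\<close>, so that \<open>H\<close> is an automorphism of the disc and \<open>F\<close> has order
  three, or else the value \<open>H z\<^sub>2\<close> may be moved freely in a small neighbourhood, and the maximum
  modulus principle shows that some such move increases \<open>m(F z\<^sub>1, F z\<^sub>2)\<close>, a contradiction
  (\<open>extremal_self_map_blaschke\<close>). Undoing the normalisation needs that \<open>\<phi>\<^sub>b \<circ> B\<close> is a Blaschke product
  of the same order as \<open>B\<close> (\<open>blaschke_product_compose_disc_aut\<close>).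

  Uniqueness follows by convexity: the average of two extremal functions with the same values at
  \<open>z\<^sub>1\<close> and \<open>z\<^sub>2\<close> is extremal too, so all three are Blaschke products and have modulus one on the
  unit circle. As a unimodular number is not the average of two different ones, the two functions
  agree on the circle, and so on the disc.
\<close>

section \<open>Automorphisms of the disc and the pseudohyperbolic distance\<close>

lemma disc_aut_denominator_nonzero:
  assumes "norm a < 1" "norm z \<le> 1"
  shows "1 - cnj a * z \<noteq> 0"
proof
  assume "1 - cnj a * z = 0"
  then have "norm a * norm z = 1"
    by (metis complex_mod_cnj eq_iff_diff_eq_0 norm_mult norm_one)
  moreover have "norm a * norm z < 1"
    using mult_left_le[OF assms(2) norm_ge_zero[of a]] assms(1) by linarith
  ultimately show False by simp
qed

text \<open>This one identity decides on which side of the unit circle \<^term>\<open>disc_aut a z\<close> lies: for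
  \<open>z\<close> inside the disc, on the circle, and (for the factors of a Blaschke product) outside it.\<close>

lemma norm_denominator_minus_numerator:
  "(norm (1 - cnj a * z))\<^sup>2 - (norm (a - z))\<^sup>2 = (1 - (norm a)\<^sup>2) * (1 - (norm z)\<^sup>2)"
proof -
  have "complex_of_real ((norm (1 - cnj a * z))\<^sup>2 - (norm (a - z))\<^sup>2)
      = complex_of_real ((1 - (norm a)\<^sup>2) * (1 - (norm z)\<^sup>2))"
    unfolding of_real_diff of_real_mult complex_norm_square of_real_1
    by (simp add: algebra_simps)
  then show ?thesis
    using of_real_eq_iff by blast
qed

lemma disc_aut_norm_defect:
  assumes "1 - cnj a * z \<noteq> 0"
  shows "1 - (norm (disc_aut a z))\<^sup>2 = (1 - (norm a)\<^sup>2) * (1 - (norm z)\<^sup>2) / (norm (1 - cnj a * z))\<^sup>2"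
  using assms norm_denominator_minus_numerator[of a z]
  by (simp add: disc_aut_def norm_divide power_divide field_simps)

lemma norm_disc_aut_less_1:
  assumes "norm a < 1" "norm z < 1"
  shows "norm (disc_aut a z) < 1"
proof -
  have nz: "1 - cnj a * z \<noteq> 0"
    using assms by (intro disc_aut_denominator_nonzero) auto
  have "(norm a)\<^sup>2 < 1" "(norm z)\<^sup>2 < 1"
    using assms by (simp_all add: abs_square_less_1)
  then have "0 < 1 - (norm (disc_aut a z))\<^sup>2"
    unfolding disc_aut_norm_defect[OF nz] using nz by simp
  then show ?thesis
    by (simp add: abs_square_less_1)
qed

lemma norm_disc_aut_eq_1:
  assumes "norm a < 1" "norm z = 1"
  shows "norm (disc_aut a z) = 1"
proof -
  have nz: "1 - cnj a * z \<noteq> 0"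
    using assms by (intro disc_aut_denominator_nonzero) auto
  have "1 - (norm (disc_aut a z))\<^sup>2 = 0"
    unfolding disc_aut_norm_defect[OF nz] using assms by simp
  then show ?thesis
    by (smt (verit) norm_ge_zero power2_eq_1_iff)
qed

lemma disc_aut_self [simp]: "disc_aut a a = 0"
  by (simp add: disc_aut_def)

lemma disc_aut_zero [simp]: "disc_aut a 0 = a"
  by (simp add: disc_aut_def)

lemma disc_aut_eq_0_iff:
  assumes "norm a < 1" "norm z < 1"
  shows "disc_aut a z = 0 \<longleftrightarrow> z = a"
  using assms disc_aut_denominator_nonzero[of a z] by (auto simp: disc_aut_def)

lemma disc_aut_involution:
  assumes "norm a < 1" "norm z < 1"
  shows "disc_aut a (disc_aut a z) = z"
proof -
  have nz: "1 - cnj a * z \<noteq> 0"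
    using assms by (intro disc_aut_denominator_nonzero) auto
  have nz2: "1 - cnj a * disc_aut a z \<noteq> 0"
    using assms norm_disc_aut_less_1[OF assms] by (intro disc_aut_denominator_nonzero) auto
  have "a - disc_aut a z = z * (1 - cnj a * disc_aut a z)"
    using nz by (simp add: disc_aut_def field_simps)
  then show ?thesis
    using nz2 unfolding disc_aut_def[of a "disc_aut a z"] by simp
qed

lemma disc_aut_holomorphic:
  assumes "norm a < 1"
  shows "disc_aut a holomorphic_on ball 0 1"
  unfolding disc_aut_def[abs_def]
  using disc_aut_denominator_nonzero[OF assms] by (intro holomorphic_intros) auto

lemma disc_aut_continuous_on_cball:
  assumes "norm a < 1"
  shows "continuous_on (cball 0 1) (disc_aut a)"
  unfolding disc_aut_def[abs_def]
  using disc_aut_denominator_nonzero[OF assms] by (intro continuous_intros) auto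

lemma pseudo_hyperbolic_dist_eq: "pseudo_hyperbolic_dist a b = norm (disc_aut a b)"
  by (simp add: pseudo_hyperbolic_dist_def disc_aut_def)

lemma pseudo_hyperbolic_dist_disc_aut:
  assumes "norm a < 1" "norm x < 1" "norm y < 1"
  shows "pseudo_hyperbolic_dist (disc_aut a x) (disc_aut a y) = pseudo_hyperbolic_dist x y"
proof -
  have nz: "1 - cnj a * x \<noteq> 0" "1 - cnj a * y \<noteq> 0" "1 - cnj x * y \<noteq> 0" "1 - cnj a * a \<noteq> 0"
    by (rule disc_aut_denominator_nonzero; use assms in simp)+
  have nz': "1 - a * cnj x \<noteq> 0"
    using nz(1) by (metis complex_cnj_cnj complex_cnj_diff complex_cnj_mult complex_cnj_one complex_cnj_zero_iff)
  have num: "disc_aut a x - disc_aut a y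
      = - (x - y) * (1 - cnj a * a) / ((1 - cnj a * x) * (1 - cnj a * y))"
    unfolding disc_aut_def diff_frac_eq[OF nz(1,2)]
    by (rule arg_cong[of _ _ "\<lambda>u. u / _"]) (simp add: algebra_simps)
  have den: "1 - cnj (disc_aut a x) * disc_aut a y
      = (1 - cnj a * a) * (1 - cnj x * y) / ((1 - a * cnj x) * (1 - cnj a * y))"
  proof -
    have "1 - cnj (disc_aut a x) * disc_aut a y
        = 1 - ((cnj a - cnj x) * (a - y)) / ((1 - a * cnj x) * (1 - cnj a * y))"
      by (simp add: disc_aut_def)
    also have "\<dots> = ((1 - a * cnj x) * (1 - cnj a * y) - (cnj a - cnj x) * (a - y))
                     / ((1 - a * cnj x) * (1 - cnj a * y))"
      using nz nz' by (subst diff_divide_distrib) simp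
    also have "(1 - a * cnj x) * (1 - cnj a * y) - (cnj a - cnj x) * (a - y)
        = (1 - cnj a * a) * (1 - cnj x * y)"
      by (simp add: algebra_simps)
    finally show ?thesis .
  qed
  have quot: "- d * D / (P * Q) / (D * R / (S * Q)) = - (d / R) * (S / P)"
    if "D \<noteq> 0" "P \<noteq> 0" "Q \<noteq> 0" "R \<noteq> 0" "S \<noteq> 0" for d D P Q R S :: complex
    using that by (simp add: field_simps)
  have "(disc_aut a x - disc_aut a y) / (1 - cnj (disc_aut a x) * disc_aut a y)
      = - ((x - y) / (1 - cnj x * y)) * ((1 - a * cnj x) / (1 - cnj a * x))"
    unfolding num den using quot[OF nz(4,1,2,3) nz'] .
  moreover have "norm (1 - a * cnj x) = norm (1 - cnj a * x)"
    by (metis complex_cnj_cnj complex_cnj_diff complex_cnj_mult complex_cnj_one complex_mod_cnj)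
  ultimately show ?thesis
    using nz unfolding pseudo_hyperbolic_dist_def by (simp add: norm_mult norm_divide)
qed

lemma pseudo_hyperbolic_dist_bounds:
  assumes "norm x < 1" "norm y < 1"
  shows "0 \<le> pseudo_hyperbolic_dist x y" "pseudo_hyperbolic_dist x y < 1"
  using assms by (auto simp: pseudo_hyperbolic_dist_eq norm_disc_aut_less_1)

lemma artanh_le_iff:
  fixes s t :: real
  assumes "0 \<le> s" "s < 1" "0 \<le> t" "t < 1"
  shows "artanh s \<le> artanh t \<longleftrightarrow> s \<le> t"
proof -
  have "artanh s \<le> artanh t \<longleftrightarrow> (1 + s) / (1 - s) \<le> (1 + t) / (1 - t)"
    using assms by (simp add: artanh_def)
  also have "\<dots> \<longleftrightarrow> s \<le> t"
    using assms by (simp add: divide_simps) (simp add: algebra_simps)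
  finally show ?thesis .
qed

lemma poincare_dist_le_iff:
  assumes "norm a < 1" "norm b < 1" "norm c < 1" "norm d < 1"
  shows "poincare_dist a b \<le> poincare_dist c d \<longleftrightarrow>
         pseudo_hyperbolic_dist a b \<le> pseudo_hyperbolic_dist c d"
  unfolding poincare_dist_def
  using assms by (intro artanh_le_iff pseudo_hyperbolic_dist_bounds)

text \<open>Moving \<open>x\<close> and \<open>c\<close> to the origin by automorphisms reduces this to multiplication by a number
  of modulus at most one.\<close>

lemma disc_two_point_interpolation:
  assumes "norm x < 1" "norm y < 1" "norm c < 1" "norm d < 1"
    and le: "pseudo_hyperbolic_dist c d \<le> pseudo_hyperbolic_dist x y"
  obtains h where "h holomorphic_on ball 0 1" "h ` ball 0 1 \<subseteq> ball 0 1" "h x = c" "h y = d"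
proof
  \<comment> \<open>If \<open>x = y\<close>, then \<open>c = d\<close> by assumption and the division by zero yields the correct \<open>t = 0\<close>.\<close>
  define t where "t = disc_aut c d / disc_aut x y"
  define h where "h z = disc_aut c (t * disc_aut x z)" for z
  have t: "norm t \<le> 1"
    using le by (auto simp: t_def norm_divide pseudo_hyperbolic_dist_eq divide_le_eq_1)
  have ty: "t * disc_aut x y = disc_aut c d"
    using le by (auto simp: t_def pseudo_hyperbolic_dist_eq)
  have inner: "norm (t * disc_aut x z) < 1" if "norm z < 1" for z
  proof -
    have "norm (t * disc_aut x z) \<le> 1 * norm (disc_aut x z)"
      unfolding norm_mult using t by (intro mult_right_mono) auto
    then show ?thesis
      using norm_disc_aut_less_1[OF assms(1) that] by linarith
  qed
  have "(\<lambda>z. t * disc_aut x z) holomorphic_on ball 0 1"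
    using disc_aut_holomorphic[OF assms(1)] by (intro holomorphic_on_mult holomorphic_on_const)
  then have "(disc_aut c \<circ> (\<lambda>z. t * disc_aut x z)) holomorphic_on ball 0 1"
    by (rule holomorphic_on_compose_gen[OF _ disc_aut_holomorphic[OF assms(3)]]) (use inner in auto)
  moreover have "(disc_aut c \<circ> (\<lambda>z. t * disc_aut x z)) = h"
    by (rule ext) (simp only: h_def o_apply)
  ultimately show "h holomorphic_on ball 0 1"
    by simp
  show "h ` ball 0 1 \<subseteq> ball 0 1"
    using norm_disc_aut_less_1[OF assms(3) inner] by (auto simp: h_def)
  show "h x = c" "h y = d"
    using assms ty by (simp_all add: h_def disc_aut_involution)
qed

section \<open>Finite Blaschke products\<close>

text \<open>The second factors \<open>y j\<close> may vanish, so the degree can be smaller than \<open>n\<close>. This happens below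
  for the denominator of a Blaschke product with a zero at the origin.\<close>

lemma linear_factors_product:
  fixes x y :: "nat \<Rightarrow> complex"
  shows "degree (\<Prod>j<n. [:x j, y j:]) \<le> n \<and> coeff (\<Prod>j<n. [:x j, y j:]) n = (\<Prod>j<n. y j)"
proof (induction n)
  case (Suc n)
  have "degree ((\<Prod>j<n. [:x j, y j:]) * [:x n, y n:]) \<le> n + 1"
    using Suc by (intro order.trans[OF degree_mult_le] add_mono) auto
  moreover have "coeff (\<Prod>j<n. [:x j, y j:]) (Suc n) = 0"
    using Suc by (intro coeff_eq_0) auto
  ultimately show ?case
    using Suc by (simp add: mult.commute)
qed simp

lemma blaschke_product_of_orderE:
  assumes "blaschke_product_of_order n F"
  obtains c \<alpha> where "norm c = 1" "\<And>j. j < n \<Longrightarrow> norm (\<alpha> j) < 1"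
    "\<And>z. norm z < 1 \<Longrightarrow> F z = c * (\<Prod>j<n. disc_aut (\<alpha> j) z)"
proof -
  obtain c \<alpha> where "norm c = 1" "\<forall>j<n. \<alpha> j \<in> unit_disc"
    "\<forall>z\<in>unit_disc. F z = c * (\<Prod>j<n. disc_aut (\<alpha> j) z)"
    using assms unfolding blaschke_product_of_order_def by blast
  then show thesis
    by (intro that[of c \<alpha>]) auto
qed

text \<open>Write \<open>F = c A / B\<close> with polynomials \<open>A\<close> and \<open>B\<close> that are, up to sign, reflections of each other
  in the unit circle. Then \<open>\<phi>\<^sub>b \<circ> F = T / S\<close> with \<open>T = b B - c A\<close> and \<open>S = B - cnj b c A\<close>, and \<open>S\<close> is
  again a unimodular multiple of the reflection of \<open>T\<close>. Factoring \<open>T\<close> into linear factors by the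
  fundamental theorem of algebra factors \<open>S\<close> at the same time. The order is preserved because \<open>T\<close>
  has degree exactly \<open>n\<close>, and its roots lie in the disc because \<open>\<bar>A\<bar> \<ge> \<bar>B\<bar>\<close> outside of it.\<close>

lemma blaschke_product_compose_disc_aut:
  assumes F: "blaschke_product_of_order n F" and b: "norm b < 1"
  shows "blaschke_product_of_order n (\<lambda>z. disc_aut b (F z))"
proof -
  obtain c \<alpha> where c: "norm c = 1" and \<alpha>: "\<And>j. j < n \<Longrightarrow> norm (\<alpha> j) < 1"
    and Fz: "\<And>z. norm z < 1 \<Longrightarrow> F z = c * (\<Prod>j<n. disc_aut (\<alpha> j) z)"
    using F by (rule blaschke_product_of_orderE) blast
  have cc: "c * cnj c = 1"
    using c by (simp add: complex_norm_square[symmetric])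
  define A where "A = (\<Prod>j<n. [:\<alpha> j, -1:])"
  define B where "B = (\<Prod>j<n. [:1, - cnj (\<alpha> j):])"
  define T where "T = smult b B - smult c A"
  define L where "L = coeff T n"
  have A_poly: "poly A z = (\<Prod>j<n. \<alpha> j - z)" for z
    by (simp add: A_def poly_prod)
  have B_poly: "poly B z = (\<Prod>j<n. 1 - cnj (\<alpha> j) * z)" for z
    by (simp add: B_def poly_prod mult.commute)
  have L: "L = b * (\<Prod>j<n. - cnj (\<alpha> j)) - c * (-1) ^ n"
    unfolding L_def T_def A_def B_def by (simp add: linear_factors_product)
  \<comment> \<open>The coefficient of degree \<open>n\<close> is a number of modulus less than one minus a unimodular one.\<close>
  have "norm (b * (\<Prod>j<n. - cnj (\<alpha> j))) < 1"
  proof -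
    have "norm (\<Prod>j<n. - cnj (\<alpha> j)) \<le> 1"
      using \<alpha> by (auto simp: prod_norm[symmetric] less_imp_le intro!: prod_le_1)
    then show ?thesis
      unfolding norm_mult using b mult_left_le[of "norm (\<Prod>j<n. - cnj (\<alpha> j))" "norm b"] by fastforce
  qed
  moreover have "norm (c * (-1) ^ n) = 1"
    using c by (simp add: norm_mult norm_power)
  ultimately have L_nz: "L \<noteq> 0"
    unfolding L by auto
  have "degree T \<le> n"
    unfolding T_def A_def B_def
    by (intro degree_diff_le order.trans[OF degree_smult_le]) (simp_all add: linear_factors_product)
  moreover have "degree T \<ge> n"
    using L_nz unfolding L_def by (rule le_degree)
  ultimately have deg: "degree T = n"
    by simp
  obtain r where r: "smult (lead_coeff T) (\<Prod>i<degree T. [:- r i, 1:]) = T"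
    by (rule complex_poly_decompose')
  have T_roots: "poly T z = L * (\<Prod>j<n. z - r j)" for z
    by (subst r[symmetric]) (simp add: deg L_def poly_prod)
  have T_AB: "poly T z = b * poly B z - c * poly A z" for z
    by (simp add: T_def)

  \<comment> \<open>The reflection of \<open>T\<close> is \<open>z\<^sup>n cnj (T (1 / cnj z))\<close>; the left side computes it from \<open>A\<close> and \<open>B\<close>,
      the right side from the roots of \<open>T\<close>. At \<open>z = 0\<close> the formula does not apply, but both sides
      are then the conjugate of the leading coefficient.\<close>
  have refl: "(-1) ^ n * (cnj b * poly A z - cnj c * poly B z) = cnj L * (\<Prod>j<n. 1 - cnj (r j) * z)" for z
  proof (cases "z = 0")
    case True
    have "cnj L = cnj b * ((-1) ^ n * (\<Prod>j<n. \<alpha> j)) - cnj c * (-1) ^ n"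
      unfolding L by (simp add: prod_uminus)
    then show ?thesis
      using True by (simp add: A_poly B_poly algebra_simps)
  next
    case False
    define w where "w = 1 / cnj z"
    have w: "cnj w = 1 / z"
      by (simp add: w_def)
    have push: "z ^ n * (\<Prod>j<n. g j) = (\<Prod>j<n. z * g j)" for g :: "nat \<Rightarrow> complex"
      by (simp add: prod.distrib)
    have pull: "(\<Prod>j<n. - g j) = (-1) ^ n * (\<Prod>j<n. g j)" for g :: "nat \<Rightarrow> complex"
      by (simp add: prod_uminus)
    have "z ^ n * cnj (poly B w) = (\<Prod>j<n. - (\<alpha> j - z))"
      unfolding B_poly cnj_prod push using False by (intro prod.cong) (auto simp: w field_simps)
    then have 1: "z ^ n * cnj (poly B w) = (-1) ^ n * poly A z"
      unfolding pull A_poly .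
    have "z ^ n * cnj (poly A w) = (\<Prod>j<n. - (1 - cnj (\<alpha> j) * z))"
      unfolding A_poly cnj_prod push using False by (intro prod.cong) (auto simp: w field_simps)
    then have 2: "z ^ n * cnj (poly A w) = (-1) ^ n * poly B z"
      unfolding pull B_poly .
    have "z ^ n * cnj (poly T w) = cnj L * (z ^ n * (\<Prod>j<n. cnj (w - r j)))"
      unfolding T_roots by simp
    also have "\<dots> = cnj L * (\<Prod>j<n. 1 - cnj (r j) * z)"
      unfolding push using False by (intro arg_cong2[of _ _ _ _ "(*)"] prod.cong) (auto simp: w field_simps)
    finally have 3: "z ^ n * cnj (poly T w) = cnj L * (\<Prod>j<n. 1 - cnj (r j) * z)" .
    have "z ^ n * cnj (poly T w) = cnj b * (z ^ n * cnj (poly B w)) - cnj c * (z ^ n * cnj (poly A w))"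
      unfolding T_AB by (simp add: algebra_simps)
    then show ?thesis
      unfolding 1 2 3 by (simp add: algebra_simps)
  qed

  have r_disc: "norm (r j) < 1" if j: "j < n" for j
  proof (rule ccontr)
    assume "\<not> norm (r j) < 1"
    then have r1: "(norm (r j))\<^sup>2 \<ge> 1"
      by (simp add: power2_eq_square one_le_mult_iff not_less) (metis mult_mono' norm_ge_zero mult_1 zero_le_one)
    have factor: "norm (1 - cnj (\<alpha> i) * r j) \<le> norm (\<alpha> i - r j)" if "i < n" for i
    proof -
      have "(norm (1 - cnj (\<alpha> i) * r j))\<^sup>2 - (norm (\<alpha> i - r j))\<^sup>2
               = (1 - (norm (\<alpha> i))\<^sup>2) * (1 - (norm (r j))\<^sup>2)"
        by (rule norm_denominator_minus_numerator)
      also have "\<dots> \<le> 0"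
        using r1 \<alpha>[OF that] by (intro mult_nonneg_nonpos) (auto simp: abs_square_le_1)
      finally show ?thesis
        by (simp add: power2_le_iff_abs_le)
    qed
    have "poly T (r j) = 0"
      unfolding T_roots using j by auto
    then have "c * poly A (r j) = b * poly B (r j)"
      by (simp add: T_AB)
    then have "norm (poly A (r j)) = norm b * norm (poly B (r j))"
      using c by (metis mult_1 norm_mult)
    also have "norm (poly B (r j)) \<le> norm (poly A (r j))"
      unfolding A_poly B_poly prod_norm[symmetric] using factor by (intro prod_mono) auto
    then have "norm b * norm (poly B (r j)) \<le> norm b * norm (poly A (r j))"
      by (rule mult_left_mono) simp
    finally have "norm (poly A (r j)) = 0"
      using b by (smt (verit) mult_le_cancel_right1 norm_ge_zero)
    then obtain i where "i < n" "\<alpha> i = r j"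
      by (auto simp: A_poly)
    then show False
      using \<alpha> \<open>\<not> norm (r j) < 1\<close> by metis
  qed

  define c' where "c' = - L / (c * cnj L)"
  have c': "norm c' = 1"
    using c L_nz by (simp add: c'_def norm_divide norm_mult)
  have "disc_aut b (F z) = c' * (\<Prod>j<n. disc_aut (r j) z)" if z: "norm z < 1" for z
  proof -
    have B_nz: "poly B z \<noteq> 0"
      unfolding B_poly using disc_aut_denominator_nonzero[OF \<alpha>, of _ z] z by (auto simp: less_imp_le)
    have F_AB: "F z = c * poly A z / poly B z"
      by (simp add: Fz[OF z] disc_aut_def prod_dividef A_poly B_poly)
    have "disc_aut b (F z) = (b * poly B z - c * poly A z) / (poly B z - cnj b * (c * poly A z))"
    proof -
      have "b - F z = (b * poly B z - c * poly A z) / poly B z"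
        using B_nz by (simp add: F_AB diff_divide_distrib)
      moreover have "1 - cnj b * F z = (poly B z - cnj b * (c * poly A z)) / poly B z"
        using B_nz by (simp add: F_AB diff_divide_distrib)
      ultimately show ?thesis
        using B_nz by (simp add: disc_aut_def)
    qed
    also have "b * poly B z - c * poly A z = (-1) ^ n * L * (\<Prod>j<n. r j - z)"
    proof -
      have "(\<Prod>j<n. z - r j) = (\<Prod>j<n. - (r j - z))"
        by simp
      also have "\<dots> = (-1) ^ n * (\<Prod>j<n. r j - z)"
        by (rule prod_uminus[where A="{..<n}", simplified])
      finally show ?thesis
        unfolding T_AB[symmetric] T_roots by simp
    qed
    also have "poly B z - cnj b * (c * poly A z) = - c * (cnj b * poly A z - cnj c * poly B z)"
    proof -
      have "- c * (cnj b * poly A z - cnj c * poly B z) = (c * cnj c) * poly B z - cnj b * (c * poly A z)"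
        by (simp add: algebra_simps)
      then show ?thesis
        by (simp add: cc)
    qed
    also have "\<dots> = - c * ((-1) ^ n * (cnj L * (\<Prod>j<n. 1 - cnj (r j) * z)))"
    proof -
      have "(-1) ^ n * ((-1) ^ n * u) = u" for u :: complex
        by (simp flip: mult.assoc power_mult_distrib)
      then show ?thesis
        unfolding refl[symmetric] by metis
    qed
    also have "(-1) ^ n * L * (\<Prod>j<n. r j - z) / (- c * ((-1) ^ n * (cnj L * (\<Prod>j<n. 1 - cnj (r j) * z))))
             = c' * ((\<Prod>j<n. r j - z) / (\<Prod>j<n. 1 - cnj (r j) * z))"
      by (simp add: c'_def)
    finally show ?thesis
      by (simp add: disc_aut_def prod_dividef)
  qed
  then show ?thesis
    unfolding blaschke_product_of_order_def using c' r_disc by (auto intro!: exI[of _ c'] exI[of _ r])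
qed

lemma blaschke_product_times_disc_aut:
  assumes "blaschke_product_of_order n G" "norm a < 1"
  shows "blaschke_product_of_order (Suc n) (\<lambda>z. disc_aut a z * G z)"
proof -
  obtain c \<alpha> where "norm c = 1" "\<forall>j<n. \<alpha> j \<in> unit_disc"
    "\<forall>z\<in>unit_disc. G z = c * (\<Prod>j<n. disc_aut (\<alpha> j) z)"
    using assms(1) unfolding blaschke_product_of_order_def by blast
  then show ?thesis
    unfolding blaschke_product_of_order_def using assms(2)
    by (intro exI[of _ c] exI[of _ "\<alpha>(n := a)"]) (auto simp: less_Suc_eq)
qed

lemma blaschke_product_cong:
  assumes "blaschke_product_of_order n F" "\<And>z. norm z < 1 \<Longrightarrow> G z = F z"
  shows "blaschke_product_of_order n G"
  using assms unfolding blaschke_product_of_order_def by auto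

lemma blaschke_product_boundary_extension:
  assumes "blaschke_product_of_order n F"
  obtains F' where "continuous_on (cball 0 1) F'" "\<And>z. norm z < 1 \<Longrightarrow> F' z = F z"
    "\<And>z. norm z = 1 \<Longrightarrow> norm (F' z) = 1"
proof -
  obtain c \<alpha> where c: "norm c = 1" and \<alpha>: "\<And>j. j < n \<Longrightarrow> norm (\<alpha> j) < 1"
    and F: "\<And>z. norm z < 1 \<Longrightarrow> F z = c * (\<Prod>j<n. disc_aut (\<alpha> j) z)"
    using assms by (rule blaschke_product_of_orderE) blast
  show thesis
  proof
    show "continuous_on (cball 0 1) (\<lambda>z. c * (\<Prod>j<n. disc_aut (\<alpha> j) z))"
      using \<alpha> by (intro continuous_on_mult continuous_on_const continuous_on_prod disc_aut_continuous_on_cball) auto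
    show "norm (c * (\<Prod>j<n. disc_aut (\<alpha> j) z)) = 1" if "norm z = 1" for z
      using c \<alpha> that by (simp add: norm_mult prod_norm[symmetric] norm_disc_aut_eq_1)
  qed (use F in auto)
qed

section \<open>The Schwarz lemma in quotient form\<close>

lemma compose_disc_aut_self_map:
  assumes "norm b < 1" "f holomorphic_on ball 0 1" "f ` ball 0 1 \<subseteq> ball 0 1"
  shows "(\<lambda>z. disc_aut b (f z)) holomorphic_on ball 0 1"
    "(\<lambda>z. disc_aut b (f z)) ` ball 0 1 \<subseteq> ball 0 1"
proof -
  show "(\<lambda>z. disc_aut b (f z)) holomorphic_on ball 0 1"
    using holomorphic_on_compose_gen[OF assms(2) disc_aut_holomorphic[OF assms(1)] assms(3)]
    by (simp add: o_def)
  show "(\<lambda>z. disc_aut b (f z)) ` ball 0 1 \<subseteq> ball 0 1"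
    using assms norm_disc_aut_less_1[OF assms(1)] by (force simp: image_subset_iff)
qed

lemma closed_disc_valued_cases:
  assumes hol: "k holomorphic_on ball 0 1" and le: "\<And>z. norm z < 1 \<Longrightarrow> norm (k z) \<le> 1"
  shows "(\<exists>c. norm c = 1 \<and> (\<forall>z\<in>ball 0 1. k z = c)) \<or> k ` ball 0 1 \<subseteq> ball 0 1"
proof (cases "\<exists>\<xi>\<in>ball 0 1. norm (k \<xi>) = 1")
  case True
  then obtain \<xi> where \<xi>: "\<xi> \<in> ball 0 1" "norm (k \<xi>) = 1" by blast
  have "k constant_on ball 0 1"
    by (rule maximum_modulus_principle[OF hol, of "ball 0 1" \<xi>]) (use \<xi> le in auto)
  then show ?thesis
    using \<xi> unfolding constant_on_def by metis
next
  case False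
  then show ?thesis
    using le by (force simp: image_subset_iff less_le)
qed

text \<open>The quotient by \<open>\<phi>\<^sub>a\<close> takes values in the closed disc. Keeping the case of a unimodular constant
  apart lets the division be iterated.\<close>

lemma Schwarz_quotient:
  assumes holf: "f holomorphic_on ball 0 1" and f_disc: "f ` ball 0 1 \<subseteq> ball 0 1"
    and a: "norm a < 1" and fa: "f a = 0"
  obtains h where "h holomorphic_on ball 0 1"
    "\<And>z. norm z < 1 \<Longrightarrow> f z = disc_aut a z * h z"
    "(\<exists>c. norm c = 1 \<and> (\<forall>z\<in>ball 0 1. h z = c)) \<or> h ` ball 0 1 \<subseteq> ball 0 1"
proof -
  define g where "g z = f (disc_aut a z)" for z
  have aut_ball: "disc_aut a ` ball 0 1 \<subseteq> ball 0 1"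
    using norm_disc_aut_less_1[OF a] by auto
  have holg: "g holomorphic_on ball 0 1"
    using holomorphic_on_compose_gen[OF disc_aut_holomorphic[OF a] holf aut_ball]
    by (simp add: g_def[abs_def] o_def)
  have g0: "g 0 = 0"
    by (simp add: g_def fa)
  have g_disc: "norm (g z) < 1" if "norm z < 1" for z
    using f_disc norm_disc_aut_less_1[OF a that] by (auto simp: g_def image_subset_iff)
  obtain k where holk: "k holomorphic_on ball 0 1" and gk: "\<And>z. norm z < 1 \<Longrightarrow> g z = z * k z"
    and k0: "deriv g 0 = k 0"
    by (rule Schwarz3[OF holg g0]) blast
  have k_le: "norm (k z) \<le> 1" if z: "norm z < 1" for z
  proof (cases "z = 0")
    case True
    then show ?thesis
      using Schwarz_Lemma(2)[OF holg g0 g_disc z] k0 by simp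
  next
    case False
    then show ?thesis
      using Schwarz_Lemma(1)[OF holg g0 g_disc z] gk[OF z] by (simp add: norm_mult)
  qed
  have k_cases: "(\<exists>c. norm c = 1 \<and> (\<forall>z\<in>ball 0 1. k z = c)) \<or> k ` ball 0 1 \<subseteq> ball 0 1"
    by (rule closed_disc_valued_cases[OF holk k_le])
  show thesis
  proof
    show "(\<lambda>z. k (disc_aut a z)) holomorphic_on ball 0 1"
      using holomorphic_on_compose_gen[OF disc_aut_holomorphic[OF a] holk aut_ball]
      by (simp add: o_def)
    show "f z = disc_aut a z * k (disc_aut a z)" if "norm z < 1" for z
      using gk[OF norm_disc_aut_less_1[OF a that]] disc_aut_involution[OF a that] by (simp add: g_def)
    show "(\<exists>c. norm c = 1 \<and> (\<forall>z\<in>ball 0 1. k (disc_aut a z) = c)) \<or>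
          (\<lambda>z. k (disc_aut a z)) ` ball 0 1 \<subseteq> ball 0 1"
      using k_cases aut_ball by (auto simp: image_subset_iff)
  qed
qed

lemma blaschke_product_of_order_1_disc_aut:
  assumes "norm a < 1" "norm c = 1"
  shows "blaschke_product_of_order 1 (\<lambda>z. c * disc_aut a z)"
  unfolding blaschke_product_of_order_def
  using assms by (intro exI[of _ c] exI[of _ "\<lambda>_. a"]) auto

text \<open>Both parts follow from dividing \<open>\<phi>\<^bsub>f(x)\<^esub> \<circ> f\<close> by \<open>\<phi>\<^sub>x\<close>: the modulus of the quotient at \<open>y\<close> is the
  ratio of the two distances, and if it is one, then the quotient is constant.\<close>

lemma Schwarz_Pick:
  assumes holf: "f holomorphic_on ball 0 1" and f_disc: "f ` ball 0 1 \<subseteq> ball 0 1"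
    and x: "norm x < 1" and y: "norm y < 1"
  shows "pseudo_hyperbolic_dist (f x) (f y) \<le> pseudo_hyperbolic_dist x y"
    and "x \<noteq> y \<Longrightarrow> pseudo_hyperbolic_dist (f x) (f y) = pseudo_hyperbolic_dist x y
           \<Longrightarrow> blaschke_product_of_order 1 f"
proof -
  have fz: "norm (f z) < 1" if "norm z < 1" for z
    using f_disc that by (auto simp: image_subset_iff)
  define g where "g z = disc_aut (f x) (f z)" for z
  have g: "g holomorphic_on ball 0 1" "g ` ball 0 1 \<subseteq> ball 0 1" "g x = 0"
    using compose_disc_aut_self_map[OF fz[OF x] holf f_disc] by (simp_all add: g_def[abs_def])
  obtain h where
    gh: "\<And>z. norm z < 1 \<Longrightarrow> g z = disc_aut x z * h z" and
    h: "(\<exists>c. norm c = 1 \<and> (\<forall>z\<in>ball 0 1. h z = c)) \<or> h ` ball 0 1 \<subseteq> ball 0 1"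
    by (rule Schwarz_quotient[OF g(1,2) x g(3)]) blast
  have gy: "pseudo_hyperbolic_dist (f x) (f y) = pseudo_hyperbolic_dist x y * norm (h y)"
    using gh[OF y] by (simp add: pseudo_hyperbolic_dist_eq g_def norm_mult)
  have "norm (h y) \<le> 1"
    using h y by (auto simp: image_subset_iff less_imp_le)
  then show "pseudo_hyperbolic_dist (f x) (f y) \<le> pseudo_hyperbolic_dist x y"
    unfolding gy by (simp add: mult_left_le pseudo_hyperbolic_dist_eq)
  assume "x \<noteq> y" and eq: "pseudo_hyperbolic_dist (f x) (f y) = pseudo_hyperbolic_dist x y"
  have "pseudo_hyperbolic_dist x y \<noteq> 0"
    using \<open>x \<noteq> y\<close> x y by (simp add: pseudo_hyperbolic_dist_eq disc_aut_eq_0_iff)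
  then have "norm (h y) = 1"
    using eq unfolding gy by simp
  then obtain c where c: "norm c = 1" "\<And>z. norm z < 1 \<Longrightarrow> h z = c"
    using h y by (fastforce simp: image_subset_iff)
  have "f z = disc_aut (f x) (c * disc_aut x z)" if z: "norm z < 1" for z
    using gh[OF z] c(2)[OF z] disc_aut_involution[OF fz[OF x] fz[OF z]]
    by (simp add: g_def mult.commute)
  then show "blaschke_product_of_order 1 f"
    using blaschke_product_compose_disc_aut[OF blaschke_product_of_order_1_disc_aut[OF x c(1)] fz[OF x]]
    by (rule blaschke_product_cong[rotated])
qed

section \<open>Self-maps of the disc with a prescribed critical point\<close>

definition critical_self_map :: "complex \<Rightarrow> (complex \<Rightarrow> complex) \<Rightarrow> bool" where
  "critical_self_map a F \<longleftrightarrow>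
     F holomorphic_on ball 0 1 \<and> F ` ball 0 1 \<subseteq> ball 0 1 \<and> deriv F a = 0"

lemma critical_self_mapD:
  assumes "critical_self_map a F"
  shows "F holomorphic_on ball 0 1" "F ` ball 0 1 \<subseteq> ball 0 1" "deriv F a = 0"
    "norm z < 1 \<Longrightarrow> norm (F z) < 1"
  using assms by (auto simp: critical_self_map_def image_subset_iff)

lemma critical_self_map_compose:
  assumes F: "critical_self_map a F" and a: "norm a < 1"
    and h: "h holomorphic_on ball 0 1" "h ` ball 0 1 \<subseteq> ball 0 1"
  shows "critical_self_map a (\<lambda>z. h (F z))"
proof -
  note F' = critical_self_mapD[OF F]
  have "F field_differentiable at a" "h field_differentiable at (F a)"
    using F'(4)[OF a] a F'(1) h(1)
    by (auto intro!: holomorphic_on_imp_differentiable_at[of _ "ball 0 1"])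
  then have "deriv (h \<circ> F) a = 0"
    by (simp add: deriv_chain F'(3))
  moreover have "(h \<circ> F) holomorphic_on ball 0 1"
    using holomorphic_on_compose_gen[OF F'(1) h(1) F'(2)] .
  ultimately show ?thesis
    using F'(2) h(2) by (auto simp: critical_self_map_def o_def image_subset_iff)
qed

lemma critical_self_map_compose_disc_aut:
  assumes "critical_self_map a F" "norm a < 1" "norm b < 1"
  shows "critical_self_map a (\<lambda>z. disc_aut b (F z))"
  using critical_self_map_compose[OF assms(1,2) disc_aut_holomorphic[OF assms(3)]]
    norm_disc_aut_less_1[OF assms(3)] by (simp add: image_subset_iff)

text \<open>Together with the next lemma this parametrizes the critical self-maps that vanish at \<open>a\<close>, up to
  the unimodular multiples of \<open>\<phi>\<^sub>a\<^sup>2\<close>. The condition on the derivative has disappeared: \<open>H\<close> is an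
  arbitrary self-map of the disc.\<close>

lemma critical_self_map_square_times:
  assumes H: "H holomorphic_on ball 0 1" "H ` ball 0 1 \<subseteq> ball 0 1" and a: "norm a < 1"
  shows "critical_self_map a (\<lambda>z. (disc_aut a z)\<^sup>2 * H z)"
proof -
  have "(\<lambda>z. (disc_aut a z)\<^sup>2 * H z) holomorphic_on ball 0 1"
    using disc_aut_holomorphic[OF a] H(1) by (intro holomorphic_on_mult holomorphic_on_power)
  moreover have "norm ((disc_aut a z)\<^sup>2 * H z) < 1" if z: "norm z < 1" for z
  proof -
    have "norm (H z) < 1"
      using H(2) z by (auto simp: image_subset_iff)
    moreover have "(norm (disc_aut a z))\<^sup>2 \<le> 1"
      using norm_disc_aut_less_1[OF a z] by (simp add: power_le_one)
    ultimately show ?thesis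
      unfolding norm_mult norm_power
      by (metis mult_le_one mult_right_mono mult_1 norm_ge_zero order_le_less_trans)
  qed
  moreover have "deriv (\<lambda>z. (disc_aut a z)\<^sup>2 * H z) a = 0"
  proof -
    have "(disc_aut a has_field_derivative deriv (disc_aut a) a) (at a)"
      "(H has_field_derivative deriv H a) (at a)"
      using disc_aut_holomorphic[OF a] H(1) a by (auto intro: holomorphic_derivI[of _ "ball 0 1"])
    then have "((\<lambda>z. (disc_aut a z)\<^sup>2 * H z) has_field_derivative 0) (at a)"
      by (auto intro!: derivative_eq_intros)
    then show ?thesis
      by (rule DERIV_imp_deriv)
  qed
  ultimately show ?thesis
    by (auto simp: critical_self_map_def)
qed

lemma critical_self_map_quotient:
  assumes F: "critical_self_map a F" and a: "norm a < 1" and Fa: "F a = 0"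
  obtains H where "H holomorphic_on ball 0 1"
    "\<And>z. norm z < 1 \<Longrightarrow> F z = (disc_aut a z)\<^sup>2 * H z"
    "(\<exists>c. norm c = 1 \<and> (\<forall>z\<in>ball 0 1. H z = c)) \<or> H ` ball 0 1 \<subseteq> ball 0 1"
proof -
  note F' = critical_self_mapD[OF F]
  obtain h where h: "h holomorphic_on ball 0 1"
    and Fh: "\<And>z. norm z < 1 \<Longrightarrow> F z = disc_aut a z * h z"
    and h_cases: "(\<exists>c. norm c = 1 \<and> (\<forall>z\<in>ball 0 1. h z = c)) \<or> h ` ball 0 1 \<subseteq> ball 0 1"
    by (rule Schwarz_quotient[OF F'(1,2) a Fa]) blast
  have nz: "1 - cnj a * a \<noteq> 0"
    using a by (intro disc_aut_denominator_nonzero) auto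
  \<comment> \<open>Since \<open>\<phi>\<^sub>a\<close> has a simple zero at \<open>a\<close>, the condition \<open>F'(a) = 0\<close> says that \<open>h\<close> vanishes there.\<close>
  have "h a = 0"
  proof -
    have "((\<lambda>z. (a - z) / (1 - cnj a * z)) has_field_derivative
            ((0 - 1) * (1 - cnj a * a) - (a - a) * (0 - cnj a * 1)) / ((1 - cnj a * a) * (1 - cnj a * a))) (at a)"
      using nz by (intro DERIV_divide DERIV_diff DERIV_cmult DERIV_const DERIV_ident)
    moreover have "((0 - 1) * D - (a - a) * (0 - cnj a * 1)) / (D * D) = - 1 / D" if "D \<noteq> 0" for D
      using that by simp
    ultimately have "((\<lambda>z. (a - z) / (1 - cnj a * z)) has_field_derivative - 1 / (1 - cnj a * a)) (at a)"
      using nz by metis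
    moreover have "(h has_field_derivative deriv h a) (at a)"
      using h a by (auto intro: holomorphic_derivI[of _ "ball 0 1"])
    ultimately have "((\<lambda>z. disc_aut a z * h z) has_field_derivative - h a / (1 - cnj a * a)) (at a)"
      unfolding disc_aut_def by (auto dest: DERIV_mult)
    then have "(F has_field_derivative - h a / (1 - cnj a * a)) (at a)"
      by (rule has_field_derivative_transform_within_open[of _ _ _ "ball 0 1"]) (use a Fh in auto)
    then have "deriv F a = - h a / (1 - cnj a * a)"
      by (rule DERIV_imp_deriv)
    then show ?thesis
      using F'(3) nz by simp
  qed
  then have "h ` ball 0 1 \<subseteq> ball 0 1"
    using h_cases a by auto
  from Schwarz_quotient[OF h this a \<open>h a = 0\<close>] obtain H where "H holomorphic_on ball 0 1"
    and hH: "\<And>z. norm z < 1 \<Longrightarrow> h z = disc_aut a z * H z"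
    and "(\<exists>c. norm c = 1 \<and> (\<forall>z\<in>ball 0 1. H z = c)) \<or> H ` ball 0 1 \<subseteq> ball 0 1"
    by blast
  then show thesis
    using Fh by (intro that[of H]) (auto simp: power2_eq_square)
qed

section \<open>Extremal functions\<close>

definition extremal_self_map :: "complex \<Rightarrow> complex \<Rightarrow> complex \<Rightarrow> (complex \<Rightarrow> complex) \<Rightarrow> bool" where
  "extremal_self_map a z1 z2 F \<longleftrightarrow> critical_self_map a F \<and>
     (\<forall>G. critical_self_map a G \<longrightarrow>
        pseudo_hyperbolic_dist (G z1) (G z2) \<le> pseudo_hyperbolic_dist (F z1) (F z2))"

text \<open>A maximizing sequence, normalized to vanish at \<open>z1\<close>, has a locally uniform limit by Montel's
  theorem. The normalization turns the distance into the modulus at \<open>z2\<close>, and it excludes that the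
  limit is a unimodular constant.\<close>

lemma extremal_self_map_exists:
  assumes a: "norm a < 1" and z1: "norm z1 < 1" and z2: "norm z2 < 1"
  obtains F where "extremal_self_map a z1 z2 F"
proof -
  define S where "S = {pseudo_hyperbolic_dist (G z1) (G z2) |G. critical_self_map a G}"
  have "critical_self_map a (\<lambda>_. 0)"
    by (auto simp: critical_self_map_def)
  then have ne: "S \<noteq> {}"
    by (auto simp: S_def)
  have bdd: "bdd_above S"
    using Schwarz_Pick(1)[OF _ _ z1 z2]
    by (intro bdd_aboveI[of _ "pseudo_hyperbolic_dist z1 z2"]) (auto simp: S_def critical_self_map_def)
  define \<H> where "\<H> = {E. critical_self_map a E \<and> E z1 = 0}"
  have "\<exists>E\<in>\<H>. Sup S - 1 / Suc n < norm (E z2) \<and> norm (E z2) \<le> Sup S" for n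
  proof -
    obtain s where "s \<in> S" "Sup S - 1 / Suc n < s"
      using less_cSup_iff[OF ne bdd, of "Sup S - 1 / Suc n"] by auto
    then obtain G where G: "critical_self_map a G"
      and less: "Sup S - 1 / Suc n < pseudo_hyperbolic_dist (G z1) (G z2)"
      by (auto simp: S_def)
    have "pseudo_hyperbolic_dist (G z1) (G z2) \<le> Sup S"
      using G by (intro cSup_upper bdd) (auto simp: S_def)
    moreover have "critical_self_map a (\<lambda>z. disc_aut (G z1) (G z))"
      using critical_self_map_compose_disc_aut[OF G a critical_self_mapD(4)[OF G z1]] .
    ultimately show ?thesis
      using less by (intro bexI[of _ "\<lambda>z. disc_aut (G z1) (G z)"])
        (auto simp: \<H>_def pseudo_hyperbolic_dist_eq)
  qed
  then obtain E where E: "\<And>n. E n \<in> \<H>"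
    and E_lower: "\<And>n. Sup S - 1 / Suc n < norm (E n z2)" and E_upper: "\<And>n. norm (E n z2) \<le> Sup S"
    by metis
  have E_crit: "critical_self_map a (E n)" "E n z1 = 0" for n
    using E by (auto simp: \<H>_def)
  obtain g r where holg: "g holomorphic_on ball 0 1" and r: "strict_mono r"
    and lim: "\<And>x. x \<in> ball 0 1 \<Longrightarrow> (\<lambda>n. E (r n) x) \<longlonglongrightarrow> g x"
    and ulim: "\<And>K. compact K \<Longrightarrow> K \<subseteq> ball 0 1 \<Longrightarrow> uniform_limit K (E \<circ> r) g sequentially"
  proof (rule Montel[of "ball 0 1" \<H> E])
    show "\<exists>B. \<forall>h\<in>\<H>. \<forall>z\<in>K. norm (h z) \<le> B" if "compact K" "K \<subseteq> ball 0 1" for K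
      using that by (intro exI[of _ 1]) (fastforce simp: \<H>_def critical_self_map_def image_subset_iff)
    show "h holomorphic_on ball 0 1" if "h \<in> \<H>" for h
      using that by (simp add: \<H>_def critical_self_map_def)
    show "range E \<subseteq> \<H>"
      using E by blast
  qed auto
  have g_le: "norm (g z) \<le> 1" if z: "norm z < 1" for z
  proof (rule LIMSEQ_le_const2[OF tendsto_norm[OF lim]])
    show "\<exists>N. \<forall>n\<ge>N. norm (E (r n) z) \<le> 1"
      using critical_self_mapD(4)[OF E_crit(1) z] less_imp_le by blast
  qed (use z in auto)
  have gz1: "g z1 = 0"
    using lim[of z1] z1 by (simp add: E_crit LIMSEQ_const_iff)
  have "g ` ball 0 1 \<subseteq> ball 0 1"
    using closed_disc_valued_cases[OF holg g_le] gz1 z1 by auto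
  moreover have "deriv g a = 0"
  proof -
    obtain e where e: "e > 0" "cball a e \<subseteq> ball 0 1"
      using a open_contains_cball[of "ball 0 (1::real) :: complex set"] mem_ball_0 open_ball by metis
    have "uniform_limit (ball a e) (E \<circ> r) g sequentially"
      by (rule uniform_limit_on_subset[OF ulim[OF compact_cball e(2)]]) auto
    moreover have "\<forall>n. (E \<circ> r) n holomorphic_on ball a e"
      using e(2) ball_subset_cball[of a e]
      by (metis comp_apply holomorphic_on_subset subset_trans critical_self_mapD(1) E_crit(1))
    ultimately have "(\<lambda>n. deriv ((E \<circ> r) n) a) \<longlonglongrightarrow> deriv g a"
      by (rule deriv_complex_uniform_limit[OF _ always_eventually]) (use e in simp_all)
    then show ?thesis
      using critical_self_mapD(3)[OF E_crit(1)] by (simp add: LIMSEQ_const_iff)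
  qed
  ultimately have g: "critical_self_map a g"
    using holg by (simp add: critical_self_map_def)
  have "(\<lambda>n. norm (E n z2)) \<longlonglongrightarrow> Sup S"
  proof (rule tendsto_sandwich)
    have "(\<lambda>n. Sup S - 1 / Suc n) \<longlonglongrightarrow> Sup S - 0"
      by (intro tendsto_intros LIMSEQ_Suc[OF lim_1_over_n])
    then show "(\<lambda>n. Sup S - 1 / Suc n) \<longlonglongrightarrow> Sup S" by simp
    show "\<forall>\<^sub>F n in sequentially. Sup S - 1 / Suc n \<le> norm (E n z2)"
      using E_lower by (intro always_eventually allI less_imp_le)
    show "\<forall>\<^sub>F n in sequentially. norm (E n z2) \<le> Sup S"
      using E_upper by (intro always_eventually allI)
  qed simp
  then have "(\<lambda>n. norm (E (r n) z2)) \<longlonglongrightarrow> Sup S"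
    using LIMSEQ_subseq_LIMSEQ[OF _ r] by (auto simp: o_def)
  moreover have "(\<lambda>n. norm (E (r n) z2)) \<longlonglongrightarrow> norm (g z2)"
    using z2 by (intro tendsto_norm lim) auto
  ultimately have "norm (g z2) = Sup S"
    using LIMSEQ_unique by blast
  then have "pseudo_hyperbolic_dist (g z1) (g z2) = Sup S"
    by (simp add: pseudo_hyperbolic_dist_eq gz1 disc_aut_def)
  then have "extremal_self_map a z1 z2 g"
    unfolding extremal_self_map_def using g cSup_upper[OF _ bdd] by (auto simp: S_def)
  then show thesis by (rule that)
qed

text \<open>The map \<open>d \<mapsto> \<phi>\<^sub>u(q d)\<close> is holomorphic and injective, so its modulus has no local maximum.\<close>

lemma disc_aut_dist_no_local_max:
  assumes u: "norm u < 1" and q: "q \<noteq> 0" "norm q \<le> 1" and e: "e > 0" "ball d e \<subseteq> ball 0 1"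
  shows "\<exists>d'\<in>ball d e. norm (disc_aut u (q * d)) < norm (disc_aut u (q * d'))"
proof (rule ccontr)
  assume "\<not> ?thesis"
  then have max: "norm (disc_aut u (q * d')) \<le> norm (disc_aut u (q * d))" if "d' \<in> ball d e" for d'
    using that by force
  have qd: "norm (q * d') < 1" if "d' \<in> ball d e" for d'
  proof -
    have "norm d' < 1" using that e by auto
    then show ?thesis
      unfolding norm_mult using q(2) mult_right_mono[OF q(2) norm_ge_zero[of d']] by linarith
  qed
  have "(\<lambda>x. q * x) holomorphic_on ball d e"
    by (intro holomorphic_intros)
  then have "(disc_aut u \<circ> (\<lambda>x. q * x)) holomorphic_on ball d e"
    by (rule holomorphic_on_compose_gen[OF _ disc_aut_holomorphic[OF u]]) (use qd in auto)
  then have "(disc_aut u \<circ> (\<lambda>x. q * x)) constant_on ball d e"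
    by (rule maximum_modulus_principle[of _ _ "ball d e" d]) (use e max in auto)
  then obtain k where k: "\<And>x. x \<in> ball d e \<Longrightarrow> disc_aut u (q * x) = k"
    unfolding constant_on_def by auto
  have "q * x = disc_aut u k" if "x \<in> ball d e" for x
    using disc_aut_involution[OF u qd[OF that]] k[OF that] by simp
  moreover have "d \<in> ball d e" "d + of_real (e / 2) \<in> ball d e"
    using e(1) by (auto simp: dist_norm)
  ultimately have "q * d = q * (d + of_real (e / 2))"
    by metis
  then show False
    using q(1) e(1) by simp
qed

text \<open>After normalization \<open>F = \<phi>\<^sub>a\<^sup>2 H\<close>, and the order of \<open>F\<close> is two more than that of \<open>H\<close>. If \<open>H\<close> is
  neither a unimodular constant nor an automorphism, then \<open>m(H z1, H z2) < m(z1, z2)\<close> leaves room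
  to interpolate \<open>H z1\<close> and any value close to \<open>H z2\<close>. As \<open>\<phi>\<^sub>a z2 \<noteq> 0\<close>, this moves the value of
  \<open>\<phi>\<^sub>a\<^sup>2 H\<close> at \<open>z2\<close> in every direction, in particular further away from the value at \<open>z1\<close>.\<close>

lemma extremal_self_map_blaschke:
  assumes ext: "extremal_self_map a z1 z2 F"
    and a: "norm a < 1" and z1: "norm z1 < 1" and z2: "norm z2 < 1" and "z1 \<noteq> z2" "z2 \<noteq> a"
  shows "blaschke_product_of_order 2 F \<or> blaschke_product_of_order 3 F"
proof -
  have F: "critical_self_map a F"
    and F_max: "\<And>G. critical_self_map a G \<Longrightarrow>
        pseudo_hyperbolic_dist (G z1) (G z2) \<le> pseudo_hyperbolic_dist (F z1) (F z2)"
    using ext by (auto simp: extremal_self_map_def)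
  note F_disc = critical_self_mapD(4)[OF F]
  define E where "E z = disc_aut (F a) (F z)" for z
  have E: "critical_self_map a E"
    using critical_self_map_compose_disc_aut[OF F a F_disc[OF a]] by (simp add: E_def[abs_def])
  have E_dist: "pseudo_hyperbolic_dist (E z1) (E z2) = pseudo_hyperbolic_dist (F z1) (F z2)"
    unfolding E_def by (intro pseudo_hyperbolic_dist_disc_aut F_disc a z1 z2)
  have "E a = 0" by (simp add: E_def)
  then obtain H where H: "H holomorphic_on ball 0 1"
    and EH: "\<And>z. norm z < 1 \<Longrightarrow> E z = (disc_aut a z)\<^sup>2 * H z"
    and H_cases: "(\<exists>c. norm c = 1 \<and> (\<forall>z\<in>ball 0 1. H z = c)) \<or> H ` ball 0 1 \<subseteq> ball 0 1"
    using critical_self_map_quotient[OF E a] by blast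
  have lift: "blaschke_product_of_order (Suc (Suc n)) F" if "blaschke_product_of_order n H" for n
  proof -
    have "blaschke_product_of_order (Suc (Suc n)) E"
      by (rule blaschke_product_cong[OF blaschke_product_times_disc_aut[OF blaschke_product_times_disc_aut[OF that a] a]])
        (simp add: EH power2_eq_square)
    then have "blaschke_product_of_order (Suc (Suc n)) (\<lambda>z. disc_aut (F a) (E z))"
      by (rule blaschke_product_compose_disc_aut[OF _ F_disc[OF a]])
    then show ?thesis
      by (rule blaschke_product_cong) (simp add: E_def disc_aut_involution F_disc a)
  qed
  from H_cases show ?thesis
  proof
    assume "\<exists>c. norm c = 1 \<and> (\<forall>z\<in>ball 0 1. H z = c)"
    then have "blaschke_product_of_order 0 H"
      by (auto simp: blaschke_product_of_order_def)
    from lift[OF this] show ?thesis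
      by (simp add: numeral_2_eq_2)
  next
    assume H_disc: "H ` ball 0 1 \<subseteq> ball 0 1"
    have Hz: "norm (H z) < 1" if "norm z < 1" for z
      using H_disc that by (auto simp: image_subset_iff)
    define c d where "c = H z1" and "d = H z2"
    have cd: "norm c < 1" "norm d < 1"
      using Hz z1 z2 by (auto simp: c_def d_def)
    show ?thesis
    proof (cases "pseudo_hyperbolic_dist c d = pseudo_hyperbolic_dist z1 z2")
      case True
      then have "blaschke_product_of_order 1 H"
        using Schwarz_Pick(2)[OF H H_disc z1 z2 \<open>z1 \<noteq> z2\<close>] by (simp add: c_def d_def)
      from lift[OF this] show ?thesis
        by (simp add: numeral_3_eq_3)
    next
      case False
      then have less: "pseudo_hyperbolic_dist c d < pseudo_hyperbolic_dist z1 z2"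
        using Schwarz_Pick(1)[OF H H_disc z1 z2] by (simp add: c_def d_def)
      have "isCont (disc_aut c) d"
        using holomorphic_on_imp_continuous_on[OF disc_aut_holomorphic[OF cd(1)]] cd(2)
        by (simp add: continuous_on_eq_continuous_at)
      then have "((\<lambda>d'. norm (disc_aut c d')) \<longlongrightarrow> norm (disc_aut c d)) (nhds d)"
        by (intro tendsto_norm) (simp add: continuous_at tendsto_nhds_iff)
      then have "eventually (\<lambda>d'. norm (disc_aut c d') < pseudo_hyperbolic_dist z1 z2) (nhds d)"
        using less by (intro order_tendstoD(2)) (auto simp: pseudo_hyperbolic_dist_eq[of c d])
      moreover have "eventually (\<lambda>d'. d' \<in> ball 0 1) (nhds d)"
        using cd(2) by (intro eventually_nhds_in_open) auto
      ultimately have "eventually (\<lambda>d'. norm (disc_aut c d') < pseudo_hyperbolic_dist z1 z2 \<and> d' \<in> ball 0 1) (nhds d)"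
        by (rule eventually_conj)
      then obtain e where e: "e > 0"
        and near: "\<And>d'. dist d' d < e \<Longrightarrow> norm (disc_aut c d') < pseudo_hyperbolic_dist z1 z2 \<and> d' \<in> ball 0 1"
        unfolding eventually_nhds_metric by blast
      define p q where "p = (disc_aut a z1)\<^sup>2" and "q = (disc_aut a z2)\<^sup>2"
      have pq: "norm p \<le> 1" "norm q \<le> 1"
        using norm_disc_aut_less_1[OF a z1] norm_disc_aut_less_1[OF a z2]
        by (auto simp: p_def q_def norm_power power_le_one)
      have "q \<noteq> 0"
        using \<open>z2 \<noteq> a\<close> a z2 by (simp add: q_def disc_aut_eq_0_iff)
      have u: "norm (p * c) < 1"
        unfolding norm_mult using cd(1) mult_right_mono[OF pq(1) norm_ge_zero[of c]] by linarith
      have sub: "ball d e \<subseteq> ball 0 1"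
        using near by (auto simp: dist_commute)
      obtain d' where d': "d' \<in> ball d e"
        and larger: "norm (disc_aut (p * c) (q * d)) < norm (disc_aut (p * c) (q * d'))"
        using disc_aut_dist_no_local_max[OF u \<open>q \<noteq> 0\<close> pq(2) e sub] by blast
      have "pseudo_hyperbolic_dist c d' \<le> pseudo_hyperbolic_dist z1 z2" "norm d' < 1"
        using near[of d'] d' by (auto simp: dist_commute pseudo_hyperbolic_dist_eq[of c])
      then obtain K where K: "K holomorphic_on ball 0 1" "K ` ball 0 1 \<subseteq> ball 0 1"
        and Kz: "K z1 = c" "K z2 = d'"
        using disc_two_point_interpolation[OF z1 z2 cd(1)] by metis
      have "pseudo_hyperbolic_dist (p * c) (q * d') \<le> pseudo_hyperbolic_dist (F z1) (F z2)"
        using F_max[OF critical_self_map_square_times[OF K a]] by (simp add: Kz p_def q_def)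
      also have "\<dots> = pseudo_hyperbolic_dist (p * c) (q * d)"
        unfolding E_dist[symmetric] by (simp add: EH z1 z2 p_def q_def c_def d_def)
      finally show ?thesis
        using larger by (simp add: pseudo_hyperbolic_dist_eq)
    qed
  qed
qed

lemma critical_self_map_average:
  assumes F: "critical_self_map a F" and G: "critical_self_map a G" and a: "norm a < 1"
  shows "critical_self_map a (\<lambda>z. (F z + G z) / 2)"
proof -
  have "norm ((F z + G z) / 2) < 1" if "norm z < 1" for z
    using critical_self_mapD(4)[OF F that] critical_self_mapD(4)[OF G that] norm_triangle_ineq[of "F z" "G z"]
    by (simp add: norm_divide)
  moreover have "(F has_field_derivative 0) (at a)" "(G has_field_derivative 0) (at a)"
    using critical_self_mapD(1,3)[OF F] critical_self_mapD(1,3)[OF G] a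
    by (metis holomorphic_derivI mem_ball_0 open_ball)+
  then have "((\<lambda>z. (F z + G z) / 2) has_field_derivative 0) (at a)"
    by (auto intro!: derivative_eq_intros)
  then have "deriv (\<lambda>z. (F z + G z) / 2) a = 0"
    by (rule DERIV_imp_deriv)
  moreover have "(\<lambda>z. (F z + G z) / 2) holomorphic_on ball 0 1"
    using critical_self_mapD(1)[OF F] critical_self_mapD(1)[OF G]
    by (intro holomorphic_on_divide holomorphic_on_add holomorphic_on_const) auto
  ultimately show ?thesis
    by (auto simp: critical_self_map_def)
qed

lemma unimodular_average_imp_eq:
  fixes x y :: complex
  assumes "norm x = 1" "norm y = 1" "norm ((x + y) / 2) = 1"
  shows "x = y"
proof -
  have "norm (x + y) = 2"
    using assms(3) by (simp add: norm_divide)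
  moreover have "(norm (x + y))\<^sup>2 + (norm (x - y))\<^sup>2 = 2 * (norm x)\<^sup>2 + 2 * (norm y)\<^sup>2"
    unfolding cmod_power2 by (simp add: power2_eq_square algebra_simps)
  ultimately show ?thesis
    using assms by simp
qed

text \<open>All three functions extend continuously to the circle with modulus one there, so \<open>F\<close> and \<open>G\<close>
  agree on the circle by strict convexity of the disc, and inside by the maximum principle.\<close>

lemma blaschke_products_with_blaschke_average_eq:
  assumes F: "blaschke_product_of_order m F" and G: "blaschke_product_of_order n G"
    and A: "blaschke_product_of_order l (\<lambda>z. (F z + G z) / 2)"
    and holF: "F holomorphic_on ball 0 1" and holG: "G holomorphic_on ball 0 1"
    and z: "norm z < 1"
  shows "F z = G z"
proof -
  obtain F' where F': "continuous_on (cball 0 1) F'" "\<And>z. norm z < 1 \<Longrightarrow> F' z = F z"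
    "\<And>z. norm z = 1 \<Longrightarrow> norm (F' z) = 1"
    using blaschke_product_boundary_extension[OF F] by blast
  obtain G' where G': "continuous_on (cball 0 1) G'" "\<And>z. norm z < 1 \<Longrightarrow> G' z = G z"
    "\<And>z. norm z = 1 \<Longrightarrow> norm (G' z) = 1"
    using blaschke_product_boundary_extension[OF G] by blast
  obtain A' where A': "continuous_on (cball 0 1) A'" "\<And>z. norm z < 1 \<Longrightarrow> A' z = (F z + G z) / 2"
    "\<And>z. norm z = 1 \<Longrightarrow> norm (A' z) = 1"
    using blaschke_product_boundary_extension[OF A] by blast
  have cl: "closure (ball 0 1) = (cball 0 1 :: complex set)"
    by simp
  have "A' \<zeta> - (F' \<zeta> + G' \<zeta>) / 2 = 0" if "\<zeta> \<in> cball 0 1" for \<zeta>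
    by (rule continuous_constant_on_closure[of "ball 0 1" "\<lambda>z. A' z - (F' z + G' z) / 2"])
      (use F' G' A' that in \<open>auto simp: cl intro!: continuous_intros\<close>)
  then have avg: "(F' \<zeta> + G' \<zeta>) / 2 = A' \<zeta>" if "norm \<zeta> = 1" for \<zeta>
    using that by simp
  have bd: "F' \<zeta> = G' \<zeta>" if "norm \<zeta> = 1" for \<zeta>
    using unimodular_average_imp_eq[OF F'(3)[OF that] G'(3)[OF that]] A'(3)[OF that]
    unfolding avg[OF that] by blast
  have hol: "(\<lambda>z. F' z - G' z) holomorphic_on ball 0 1"
  proof (rule holomorphic_transform)
    show "(\<lambda>z. F z - G z) holomorphic_on ball 0 1"
      using holF holG by (rule holomorphic_on_diff)
  qed (use F' G' in auto)
  have cont: "continuous_on (cball 0 1) (\<lambda>z. F' z - G' z)"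
    using F' G' by (intro continuous_on_diff)
  have "norm (F' z - G' z) \<le> 0"
  proof (rule maximum_modulus_frontier[of "\<lambda>z. F' z - G' z" "ball 0 1"])
    show "norm (F' \<zeta> - G' \<zeta>) \<le> 0" if "\<zeta> \<in> frontier (ball 0 1)" for \<zeta>
      using bd[of \<zeta>] that by simp
  qed (use hol cont z in simp_all)
  then show ?thesis
    using F' G' z by simp
qed

lemma extremal_self_map_unique:
  assumes F: "extremal_self_map a z1 z2 F" and G: "extremal_self_map a z1 z2 G"
    and eq: "G z1 = F z1" "G z2 = F z2"
    and a: "norm a < 1" and z12: "norm z1 < 1" "norm z2 < 1" "z1 \<noteq> z2" "z2 \<noteq> a"
    and z: "norm z < 1"
  shows "G z = F z"
proof -
  have crit: "critical_self_map a F" "critical_self_map a G"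
    using F G by (auto simp: extremal_self_map_def)
  have "extremal_self_map a z1 z2 (\<lambda>z. (F z + G z) / 2)"
    using F critical_self_map_average[OF crit a] eq by (simp add: extremal_self_map_def)
  then obtain l where "blaschke_product_of_order l (\<lambda>z. (F z + G z) / 2)"
    using extremal_self_map_blaschke[OF _ a z12] by blast
  moreover obtain m n where "blaschke_product_of_order m F" "blaschke_product_of_order n G"
    using extremal_self_map_blaschke[OF F a z12] extremal_self_map_blaschke[OF G a z12] by blast
  ultimately show ?thesis
    using blaschke_products_with_blaschke_average_eq[of m F n G l z] critical_self_mapD(1)[OF crit(1)]
      critical_self_mapD(1)[OF crit(2)] z by simp
qed

section \<open>Holomorphic functions on the Neil parabola\<close>

lemma holomorphic2_on_affine_in_first:
  assumes E: "E holomorphic_on ball 0 1" and B: "B holomorphic_on ball 0 1"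
  shows "holomorphic2_on (\<lambda>(z, w). E w + z * B w) (ball 0 1 \<times> ball 0 1)"
  unfolding holomorphic2_on_def
proof
  fix x :: "complex \<times> complex"
  assume "x \<in> ball 0 1 \<times> ball 0 1"
  then have w: "snd x \<in> ball 0 1" by auto
  have "(E has_derivative (*) (deriv E (snd x))) (at (snd x))"
    "(B has_derivative (*) (deriv B (snd x))) (at (snd x))"
    using holomorphic_derivI[OF E open_ball w] holomorphic_derivI[OF B open_ball w]
    by (auto simp: has_field_derivative_def)
  then have EB: "((\<lambda>y. E (snd y)) has_derivative (\<lambda>v. deriv E (snd x) * snd v)) (at x)"
    "((\<lambda>y. B (snd y)) has_derivative (\<lambda>v. deriv B (snd x) * snd v)) (at x)"
    using has_derivative_compose[OF has_derivative_snd[OF has_derivative_ident]] by blast+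
  have "((\<lambda>y. E (snd y) + fst y * B (snd y)) has_derivative
        (\<lambda>v. deriv E (snd x) * snd v + (fst x * (deriv B (snd x) * snd v) + fst v * B (snd x)))) (at x)"
    by (intro has_derivative_add has_derivative_mult EB has_derivative_fst has_derivative_ident)
  moreover have "(\<lambda>v. deriv E (snd x) * snd v + (fst x * (deriv B (snd x) * snd v) + fst v * B (snd x)))
      = (\<lambda>(h, k). B (snd x) * h + (deriv E (snd x) + fst x * deriv B (snd x)) * k)"
    by (auto simp: fun_eq_iff algebra_simps)
  moreover have "(\<lambda>(z, w). E w + z * B w) = (\<lambda>y. E (snd y) + fst y * B (snd y))"
    by (auto simp: fun_eq_iff)
  ultimately show "\<exists>a b. ((\<lambda>(z, w). E w + z * B w) has_derivative (\<lambda>(h, k). a * h + b * k)) (at x)"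
    by metis
qed

lemma neil_param_in_neil_parabola:
  assumes "norm l < 1"
  shows "neil_param l \<in> neil_parabola"
proof -
  have "norm (l ^ 3) < 1" "norm (l ^ 2) < 1"
    using assms by (simp_all add: norm_power power_less_one_iff)
  then show ?thesis
    by (simp add: neil_param_def neil_parabola_def flip: power_mult)
qed

lemma neil_parabolaE:
  assumes "x \<in> neil_parabola"
  obtains l where "norm l < 1" "x = neil_param l"
proof -
  obtain z w where x: "x = (z, w)" "norm w < 1" and zw: "z ^ 2 = w ^ 3"
    using assms by (auto simp: neil_parabola_def)
  \<comment> \<open>Away from the cusp, the parameter is \<open>z / w\<close>.\<close>
  show thesis
  proof (cases "w = 0")
    case True
    then show thesis
      using zw x by (intro that[of 0]) (auto simp: neil_param_def)
  next
    case False
    have sq: "(z / w) ^ 2 = w"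
    proof -
      have "(z / w) ^ 2 = w ^ 3 / w ^ 2"
        unfolding power_divide zw ..
      then show ?thesis
        using False by (simp add: power2_eq_square power3_eq_cube)
    qed
    have "(z / w) ^ 3 = (z / w) * (z / w) ^ 2"
      by (simp only: power2_eq_square power3_eq_cube mult.assoc)
    also have "\<dots> = z"
      unfolding sq using False by simp
    finally have cube: "(z / w) ^ 3 = z" .
    have "(norm (z / w))\<^sup>2 < 1"
      using x(2) sq by (metis norm_power)
    then have "norm (z / w) < 1"
      by (simp add: abs_square_less_1)
    then show thesis
      using sq cube x(1) by (intro that[of "z / w"]) (auto simp: neil_param_def)
  qed
qed

text \<open>By the chain rule the derivative of \<open>f \<circ> p\<close> at \<open>l\<close> has the form \<open>3 a l\<^sup>2 + 2 b l\<close>, which vanishes at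
  the cusp.\<close>

lemma critical_self_map_neil_pullback:
  assumes f: "f \<in> neil_holo_disc"
  shows "critical_self_map 0 (\<lambda>l. f (neil_param l))"
proof -
  have deriv: "\<exists>a b. ((\<lambda>l. f (neil_param l)) has_field_derivative (a * (3 * l\<^sup>2) + b * (2 * l))) (at l)"
    if l: "norm l < 1" for l
  proof -
    obtain U F where U: "open U" "neil_param l \<in> U" and F: "holomorphic2_on F U"
      and agree: "\<And>y. y \<in> U \<inter> neil_parabola \<Longrightarrow> F y = f y"
      using f neil_param_in_neil_parabola[OF l]
      unfolding neil_holo_disc_def holomorphic_on_neil_def by blast
    obtain a b where ab: "(F has_derivative (\<lambda>(h, k). a * h + b * k)) (at (neil_param l))"
      using F U unfolding holomorphic2_on_def by blast
    have param: "(neil_param has_derivative (\<lambda>h. (3 * l\<^sup>2 * h, 2 * l * h))) (at l)"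
      unfolding neil_param_def[abs_def]
      by (intro has_derivative_Pair) (auto intro!: derivative_eq_intros simp: power2_eq_square)
    have "((\<lambda>x. F (neil_param x)) has_derivative (\<lambda>h. (\<lambda>(h, k). a * h + b * k) (3 * l\<^sup>2 * h, 2 * l * h))) (at l)"
      using has_derivative_compose[OF param ab] .
    then have "((\<lambda>x. F (neil_param x)) has_field_derivative (a * (3 * l\<^sup>2) + b * (2 * l))) (at l)"
      unfolding has_field_derivative_def by (rule has_derivative_eq_rhs) (auto simp: fun_eq_iff algebra_simps)
    moreover have "open (neil_param -` U \<inter> ball 0 1)"
    proof (intro open_Int open_ball open_vimage U)
      show "continuous_on UNIV neil_param"
        unfolding neil_param_def[abs_def] by (intro continuous_intros)
    qed
    ultimately have "((\<lambda>x. f (neil_param x)) has_field_derivative (a * (3 * l\<^sup>2) + b * (2 * l))) (at l)"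
      by (rule has_field_derivative_transform_within_open)
        (use l U agree neil_param_in_neil_parabola in auto)
    then show ?thesis by blast
  qed
  have "(\<lambda>l. f (neil_param l)) holomorphic_on ball 0 1"
    using deriv by (intro holomorphic_onI) (auto simp: field_differentiable_def intro: has_field_derivative_at_within)
  moreover have "deriv (\<lambda>l. f (neil_param l)) 0 = 0"
    using deriv[of 0] by (auto intro: DERIV_imp_deriv)
  moreover have "(\<lambda>l. f (neil_param l)) ` ball 0 1 \<subseteq> ball 0 1"
    using f neil_param_in_neil_parabola by (force simp: neil_holo_disc_def image_subset_iff)
  ultimately show ?thesis
    by (simp add: critical_self_map_def)
qed

text \<open>The coefficients of \<open>E\<close> and \<open>D\<close> are the Taylor coefficients of \<open>f\<close> of even and of odd index.\<close>

lemma holomorphic_even_odd_split: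
  assumes hol: "f holomorphic_on ball 0 1"
  obtains E D where "E holomorphic_on ball 0 1" "D holomorphic_on ball 0 1"
    "D 0 = deriv f 0" "\<And>z. norm z < 1 \<Longrightarrow> f z = E (z\<^sup>2) + z * D (z\<^sup>2)"
proof -
  define c where "c n = (deriv ^^ n) f 0 / fact n" for n
  have f_sums: "(\<lambda>n. c n * z ^ n) sums f z" if "norm z < 1" for z
    using holomorphic_power_series[OF hol, of z] that by (simp add: c_def)
  have abs_conv: "summable (\<lambda>n. norm (c n * z ^ n))" if z: "norm z < 1" for z
  proof -
    obtain r where r: "norm z < r" "r < 1"
      using dense[OF z] by blast
    have "norm (complex_of_real r) < 1" "norm z < norm (complex_of_real r)"
      using r order.strict_trans1[OF norm_ge_zero r(1)] by simp_all
    then show ?thesis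
      using f_sums[of "of_real r"] by (intro powser_insidea[of _ "of_real r"]) (auto simp: sums_iff)
  qed
  have sub: "summable (\<lambda>n. c (2 * n + k) * w ^ n)" if w: "norm w < 1" for w k
  proof -
    define z where "z = csqrt w"
    have zw: "z\<^sup>2 = w" by (simp add: z_def)
    then have z: "norm z < 1"
      using w by (metis norm_power abs_norm_cancel abs_square_less_1)
    show ?thesis
    proof (cases "z = 0")
      case True
      then have "w = 0" using zw by simp
      then show ?thesis
        by simp
    next
      case False
      have "summable ((\<lambda>n. norm (c n * z ^ n)) \<circ> (\<lambda>n. 2 * n + k))"
        by (rule summable_reindex[OF abs_conv[OF z]]) (auto simp: inj_def)
      then have "summable (\<lambda>n. c (2 * n + k) * z ^ (2 * n + k))"
        unfolding o_def by (rule summable_norm_cancel)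
      then have "summable (\<lambda>n. c (2 * n + k) * z ^ (2 * n + k) / z ^ k)"
        by (rule summable_divide)
      moreover have "c (2 * n + k) * z ^ (2 * n + k) / z ^ k = c (2 * n + k) * w ^ n" for n
        using False by (simp add: power_add power_mult zw)
      ultimately show ?thesis
        by simp
    qed
  qed
  define P where "P k w = (\<Sum>n. c (2 * n + k) * w ^ n)" for k w
  have P_sums: "(\<lambda>n. c (2 * n + k) * w ^ n) sums P k w" if "norm w < 1" for k w
    unfolding P_def using sub[OF that] by (rule summable_sums)
  have P_hol: "P k holomorphic_on ball 0 1" for k
    by (rule power_series_holomorphic[of 0 1 "\<lambda>n. c (2 * n + k)"]) (simp add: P_sums)
  show thesis
  proof
    show "P 0 holomorphic_on ball 0 1" "P 1 holomorphic_on ball 0 1"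
      by (rule P_hol)+
    show "P 1 0 = deriv f 0"
      unfolding P_def powser_zero[of "\<lambda>n. c (2 * n + 1)"] by (simp add: c_def)
    fix z :: complex
    assume z: "norm z < 1"
    then have z2: "norm (z\<^sup>2) < 1"
      by (simp add: norm_power power_less_one_iff)
    have "(\<lambda>n. sum (\<lambda>n. c n * z ^ n) {n * 2..<n * 2 + 2}) sums f z"
      by (rule sums_group[OF f_sums[OF z]]) simp
    moreover have "sum (\<lambda>n. c n * z ^ n) {n * 2..<n * 2 + 2}
        = c (2 * n + 0) * (z\<^sup>2) ^ n + z * (c (2 * n + 1) * (z\<^sup>2) ^ n)" for n
    proof -
      have "{n * 2..<n * 2 + 2} = {2 * n, 2 * n + 1}"
        by auto
      then show ?thesis
        by (simp add: power_mult)
    qed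
    moreover have "(\<lambda>n. c (2 * n + 0) * (z\<^sup>2) ^ n + z * (c (2 * n + 1) * (z\<^sup>2) ^ n))
        sums (P 0 (z\<^sup>2) + z * P 1 (z\<^sup>2))"
      by (intro sums_add sums_mult P_sums z2)
    ultimately show "f z = P 0 (z\<^sup>2) + z * P 1 (z\<^sup>2)"
      using sums_unique2 by simp
  qed
qed

text \<open>If \<open>G(l) = E(l\<^sup>2) + l D(l\<^sup>2)\<close>, then \<open>D(0) = G'(0) = 0\<close>, so \<open>D(w) = w B(w)\<close> and
  \<open>G(l) = E(l\<^sup>2) + l\<^sup>3 B(l\<^sup>2)\<close>. A single holomorphic function on the bidisc thus serves as the local
  extension at every point of the parabola.\<close>

lemma critical_self_map_neil_pushforward:
  assumes G: "critical_self_map 0 G"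
  obtains f where "f \<in> neil_holo_disc" "\<And>l. norm l < 1 \<Longrightarrow> f (neil_param l) = G l"
proof -
  note G' = critical_self_mapD[OF G]
  obtain E D where E: "E holomorphic_on ball 0 1" and D: "D holomorphic_on ball 0 1"
    and D0: "D 0 = 0" and G_split: "\<And>z. norm z < 1 \<Longrightarrow> G z = E (z\<^sup>2) + z * D (z\<^sup>2)"
    using holomorphic_even_odd_split[OF G'(1)] G'(3) by metis
  obtain B where B: "B holomorphic_on ball 0 1" and D_eq: "\<And>w. norm w < 1 \<Longrightarrow> D w = w * B w"
    using Schwarz3[OF D D0] by blast
  define f where "f = (\<lambda>(z, w). E w + z * B w)"
  have f_param: "f (neil_param l) = G l" if l: "norm l < 1" for l
  proof -
    have "norm (l\<^sup>2) < 1"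
      using l by (simp add: norm_power power_less_one_iff)
    then show ?thesis
      using G_split[OF l] D_eq[of "l\<^sup>2"] by (simp add: f_def neil_param_def power2_eq_square power3_eq_cube)
  qed
  have "holomorphic2_on f (ball 0 1 \<times> ball 0 1)"
    unfolding f_def by (rule holomorphic2_on_affine_in_first[OF E B])
  then have "holomorphic_on_neil f"
    unfolding holomorphic_on_neil_def
    by (intro ballI exI[of _ "ball 0 1 \<times> ball 0 1"] exI[of _ f])
      (auto simp: neil_parabola_def open_Times)
  moreover have "f x \<in> ball 0 1" if "x \<in> neil_parabola" for x
    using that by (rule neil_parabolaE) (use f_param G'(4) in auto)
  ultimately show thesis
    using f_param by (intro that[of f]) (auto simp: neil_holo_disc_def)
qed

lemma critical_self_map_recentre:
  assumes F: "critical_self_map b F" and a: "norm a < 1" and ab: "disc_aut a a' = b" and a': "norm a' < 1"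
  shows "critical_self_map a' (\<lambda>z. F (disc_aut a z))"
proof -
  note F' = critical_self_mapD[OF F]
  have sub: "disc_aut a ` ball 0 1 \<subseteq> ball 0 1"
    using norm_disc_aut_less_1[OF a] by auto
  have "disc_aut a field_differentiable at a'" "F field_differentiable at (disc_aut a a')"
    using disc_aut_holomorphic[OF a] F'(1) a' norm_disc_aut_less_1[OF a a']
    by (auto intro!: holomorphic_on_imp_differentiable_at[of _ "ball 0 1"])
  then have "deriv (F \<circ> disc_aut a) a' = 0"
    by (simp add: deriv_chain F'(3) ab)
  moreover have "(F \<circ> disc_aut a) holomorphic_on ball 0 1"
    using holomorphic_on_compose_gen[OF disc_aut_holomorphic[OF a] F'(1) sub] .
  ultimately show ?thesis
    using F'(2) sub by (auto simp: critical_self_map_def o_def image_subset_iff)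
qed

text \<open>This removes the Neil parabola from the problem: what remains is a question about self-maps of
  the disc.\<close>

lemma caratheodory_neil_eq_Sup_critical:
  assumes a: "norm a < 1" and z1: "norm z1 < 1" and z2: "norm z2 < 1"
  shows "caratheodory_neil (neil_param (disc_aut a z1)) (neil_param (disc_aut a z2)) =
    Sup {poincare_dist (F z1) (F z2) |F. critical_self_map a F}"
proof -
  have "(\<lambda>f. poincare_dist (f (neil_param (disc_aut a z1))) (f (neil_param (disc_aut a z2)))) ` neil_holo_disc
      = {poincare_dist (F z1) (F z2) |F. critical_self_map a F}" (is "?L = ?R")
  proof
    show "?L \<subseteq> ?R"
    proof (intro image_subsetI)
      fix f assume "f \<in> neil_holo_disc"
      then have "critical_self_map a (\<lambda>z. f (neil_param (disc_aut a z)))"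
        using critical_self_map_recentre[OF critical_self_map_neil_pullback a _ a] by simp
      then show "poincare_dist (f (neil_param (disc_aut a z1))) (f (neil_param (disc_aut a z2))) \<in> ?R"
        by (intro CollectI exI[of _ "\<lambda>z. f (neil_param (disc_aut a z))"]) simp
    qed
    show "?R \<subseteq> ?L"
    proof
      fix r assume "r \<in> ?R"
      then obtain F where F: "critical_self_map a F" and r: "r = poincare_dist (F z1) (F z2)"
        by blast
      have "critical_self_map 0 (\<lambda>l. F (disc_aut a l))"
        using critical_self_map_recentre[OF F a, of 0] by simp
      then obtain f where f: "f \<in> neil_holo_disc"
        "\<And>l. norm l < 1 \<Longrightarrow> f (neil_param l) = F (disc_aut a l)"
        using critical_self_map_neil_pushforward by blast
      have "f (neil_param (disc_aut a z)) = F z" if "norm z < 1" for z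
        using f(2)[OF norm_disc_aut_less_1[OF a that]] disc_aut_involution[OF a that] by simp
      then show "r \<in> ?L"
        using f(1) z1 z2 r by (intro image_eqI[of _ _ f]) auto
    qed
  qed
  then show ?thesis
    by (simp add: caratheodory_neil_def)
qed

section \<open>Interpolation with a prescribed critical point\<close>

theorem theorem2p7:
  fixes z\<^sub>1 z\<^sub>2 z\<^sub>3 w\<^sub>1 w\<^sub>2 :: complex
  assumes "z\<^sub>1 \<in> unit_disc" "z\<^sub>2 \<in> unit_disc" "z\<^sub>3 \<in> unit_disc"
    and "z\<^sub>1 \<noteq> z\<^sub>2" "z\<^sub>1 \<noteq> z\<^sub>3" "z\<^sub>2 \<noteq> z\<^sub>3"
    and "w\<^sub>1 \<in> unit_disc" "w\<^sub>2 \<in> unit_disc"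
  shows "((\<exists>F. interpolates z\<^sub>1 z\<^sub>2 z\<^sub>3 w\<^sub>1 w\<^sub>2 F) \<longleftrightarrow>
          poincare_dist w\<^sub>1 w\<^sub>2 \<le>
            caratheodory_neil (neil_param (disc_aut z\<^sub>3 z\<^sub>1)) (neil_param (disc_aut z\<^sub>3 z\<^sub>2))) \<and>
         (poincare_dist w\<^sub>1 w\<^sub>2 =
            caratheodory_neil (neil_param (disc_aut z\<^sub>3 z\<^sub>1)) (neil_param (disc_aut z\<^sub>3 z\<^sub>2)) \<longrightarrow>
          (\<exists>F. interpolates z\<^sub>1 z\<^sub>2 z\<^sub>3 w\<^sub>1 w\<^sub>2 F \<and>
               (blaschke_product_of_order 2 F \<or> blaschke_product_of_order 3 F) \<and>
               (\<forall>G. interpolates z\<^sub>1 z\<^sub>2 z\<^sub>3 w\<^sub>1 w\<^sub>2 G \<longrightarrow> (\<forall>z\<in>unit_disc. G z = F z))))"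
proof -
  have z: "norm z\<^sub>1 < 1" "norm z\<^sub>2 < 1" "norm z\<^sub>3 < 1" and w: "norm w\<^sub>1 < 1" "norm w\<^sub>2 < 1"
    using assms by auto
  have interp: "interpolates z\<^sub>1 z\<^sub>2 z\<^sub>3 w\<^sub>1 w\<^sub>2 F \<longleftrightarrow>
      critical_self_map z\<^sub>3 F \<and> F z\<^sub>1 = w\<^sub>1 \<and> F z\<^sub>2 = w\<^sub>2" for F
    by (auto simp: interpolates_def critical_self_map_def)
  obtain F\<^sub>0 where ext: "extremal_self_map z\<^sub>3 z\<^sub>1 z\<^sub>2 F\<^sub>0"
    by (rule extremal_self_map_exists[OF z(3,1,2)])
  then have F\<^sub>0: "critical_self_map z\<^sub>3 F\<^sub>0"
    and F\<^sub>0_max: "\<And>G. critical_self_map z\<^sub>3 G \<Longrightarrow>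
      pseudo_hyperbolic_dist (G z\<^sub>1) (G z\<^sub>2) \<le> pseudo_hyperbolic_dist (F\<^sub>0 z\<^sub>1) (F\<^sub>0 z\<^sub>2)"
    by (auto simp: extremal_self_map_def)
  note F\<^sub>0_disc = critical_self_mapD(4)[OF F\<^sub>0]
  let ?c = "caratheodory_neil (neil_param (disc_aut z\<^sub>3 z\<^sub>1)) (neil_param (disc_aut z\<^sub>3 z\<^sub>2))"
  have c: "?c = poincare_dist (F\<^sub>0 z\<^sub>1) (F\<^sub>0 z\<^sub>2)"
    unfolding caratheodory_neil_eq_Sup_critical[OF z(3,1,2)]
  proof (rule cSup_eq_maximum)
    show "poincare_dist (F\<^sub>0 z\<^sub>1) (F\<^sub>0 z\<^sub>2) \<in> {poincare_dist (F z\<^sub>1) (F z\<^sub>2) |F. critical_self_map z\<^sub>3 F}"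
      using F\<^sub>0 by blast
    fix r assume "r \<in> {poincare_dist (F z\<^sub>1) (F z\<^sub>2) |F. critical_self_map z\<^sub>3 F}"
    then obtain G where "critical_self_map z\<^sub>3 G" "r = poincare_dist (G z\<^sub>1) (G z\<^sub>2)"
      by blast
    then show "r \<le> poincare_dist (F\<^sub>0 z\<^sub>1) (F\<^sub>0 z\<^sub>2)"
      using F\<^sub>0_max[of G] critical_self_mapD(4)[of z\<^sub>3 G] F\<^sub>0_disc z by (simp add: poincare_dist_le_iff)
  qed
  have le_iff: "poincare_dist w\<^sub>1 w\<^sub>2 \<le> ?c \<longleftrightarrow>
      pseudo_hyperbolic_dist w\<^sub>1 w\<^sub>2 \<le> pseudo_hyperbolic_dist (F\<^sub>0 z\<^sub>1) (F\<^sub>0 z\<^sub>2)"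
    unfolding c using w F\<^sub>0_disc z by (intro poincare_dist_le_iff) auto
  \<comment> \<open>Composing the extremal function with a self-map of the disc adjusts its two values.\<close>
  have solvable: "\<exists>F. interpolates z\<^sub>1 z\<^sub>2 z\<^sub>3 w\<^sub>1 w\<^sub>2 F" if le: "poincare_dist w\<^sub>1 w\<^sub>2 \<le> ?c"
  proof -
    obtain h where "h holomorphic_on ball 0 1" "h ` ball 0 1 \<subseteq> ball 0 1"
      and h: "h (F\<^sub>0 z\<^sub>1) = w\<^sub>1" "h (F\<^sub>0 z\<^sub>2) = w\<^sub>2"
      by (rule disc_two_point_interpolation[OF F\<^sub>0_disc[OF z(1)] F\<^sub>0_disc[OF z(2)] w le[unfolded le_iff]])
    then have "critical_self_map z\<^sub>3 (\<lambda>z. h (F\<^sub>0 z))"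
      using critical_self_map_compose[OF F\<^sub>0 z(3)] by blast
    then show ?thesis
      using h interp by blast
  qed
  have necessary: "poincare_dist w\<^sub>1 w\<^sub>2 \<le> ?c" if "interpolates z\<^sub>1 z\<^sub>2 z\<^sub>3 w\<^sub>1 w\<^sub>2 F" for F
    using that F\<^sub>0_max[of F] unfolding interp le_iff by auto
  have extremal: "\<exists>F. interpolates z\<^sub>1 z\<^sub>2 z\<^sub>3 w\<^sub>1 w\<^sub>2 F \<and>
      (blaschke_product_of_order 2 F \<or> blaschke_product_of_order 3 F) \<and>
      (\<forall>G. interpolates z\<^sub>1 z\<^sub>2 z\<^sub>3 w\<^sub>1 w\<^sub>2 G \<longrightarrow> (\<forall>z\<in>unit_disc. G z = F z))"
    if eq: "poincare_dist w\<^sub>1 w\<^sub>2 = ?c"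
  proof -
    have "pseudo_hyperbolic_dist (F\<^sub>0 z\<^sub>1) (F\<^sub>0 z\<^sub>2) \<le> pseudo_hyperbolic_dist w\<^sub>1 w\<^sub>2"
      using eq poincare_dist_le_iff[OF F\<^sub>0_disc[OF z(1)] F\<^sub>0_disc[OF z(2)] w] by (simp add: c)
    then have interp_ext: "extremal_self_map z\<^sub>3 z\<^sub>1 z\<^sub>2 G" if "interpolates z\<^sub>1 z\<^sub>2 z\<^sub>3 w\<^sub>1 w\<^sub>2 G" for G
      using that F\<^sub>0_max unfolding interp extremal_self_map_def by (blast intro: order.trans)
    obtain F where F: "interpolates z\<^sub>1 z\<^sub>2 z\<^sub>3 w\<^sub>1 w\<^sub>2 F"
      using solvable eq by auto
    have "G \<zeta> = F \<zeta>" if G: "interpolates z\<^sub>1 z\<^sub>2 z\<^sub>3 w\<^sub>1 w\<^sub>2 G" and "\<zeta> \<in> unit_disc" for G \<zeta>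
      using extremal_self_map_unique[OF interp_ext[OF F] interp_ext[OF G] _ _ z(3,1,2) assms(4,6)]
        F G that(2) unfolding interp by simp
    moreover have "blaschke_product_of_order 2 F \<or> blaschke_product_of_order 3 F"
      by (rule extremal_self_map_blaschke[OF interp_ext[OF F] z(3,1,2) assms(4,6)])
    ultimately show ?thesis
      using F by blast
  qed
  show ?thesis
    using solvable necessary extremal by blast
qed

end
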